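(* Let $n, d_1,\dots,d_n \geq 1$ be integers, let $\Lambda_1,\Lambda_2 \subset \mathbb{R}^n$ be lattices, and put $\Lambda_{i,+} := \Lambda_i \cap [0,\infty)^n$ and $L_i := 2\Lambda_i^{\vee}$ for $i=1,2$. Assume that there exist functions $a_\lambda, \tilde{a}_\mu : \mathbb{R}^n \to \mathbb{C}$ ($\lambda \in \Lambda_{1,+}$, $\mu \in \Lambda_{2,+}$) such that, for each fixed $r \in [0,\infty)^n$, $a_\lambda(r)$ and $\tilde{a}_\mu(r)$ grow at most polynomially in $\lambda$ and $\mu$ respectively, and such that the functions $$F(z,r) = \sum_{\lambda \in \Lambda_{1,+}} a_\lambda(r)\, e^{\pi i \sum_{j=1}^n z_j\lambda_j}, \qquad \tilde{F}(z,r) = \sum_{\mu \in \Lambda_{2,+}} \tilde{a}_\mu(r)\, e^{\pi i \sum_{j=1}^n z_j \mu_j}, \qquad z \in \mathbb{H}^n,$$ satisfy, for all $z \in \mathbb{H}^n$ and $r \in [0,\infty)^n$, $$e^{\pi i \sum_{j=1}^n z_j r_j^2} = F(z,r) + (z_1/i)^{-d_1/2}\cdots(z_n/i)^{-d_n/2}\, \tilde{F}(-1/z, r).$$ Then the group $\Gamma(L_1,L_2)$ is the free inner product of its subgroups $\Gamma_{\mathrm{upp}}(L_1)$ and $\Gamma_{\mathrm{low}}(L_2)$, i.e. the canonical homomorphism from the abstract free product $\Gamma_{\mathrm{upp}}(L_1) * \Gamma_{\mathrm{low}}(L_2)$ to $\Gamma(L_1,L_2)$ is an isomorphism.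
   Context: $\mathbb{H}$ is the upper half plane; $-1/z := (-1/z_1,\dots,-1/z_n)$; powers $(z_j/i)^s = \exp(s\log(z_j/i))$ use the branch of $\log$ on the right half plane that is real on $(0,\infty)$. $\Lambda^\vee$ is the dual lattice of $\Lambda \subset \mathbb{R}^n$ with respect to the standard inner product (lattices have full rank). Let $G = \mathrm{PSL}_2(\mathbb{R}^n) \cong \mathrm{PSL}_2(\mathbb{R})^n$, where $\mathbb{R}^n$ is a ring with componentwise operations. For $x \in \mathbb{R}^n$ let $T^x = \begin{pmatrix}1 & x\\ 0 & 1\end{pmatrix}$, $V^x = \begin{pmatrix}1 & 0\\ x & 1\end{pmatrix} \in G$ (with $0=(0,\dots,0)$, $1=(1,\dots,1)$); in terms of $\mathrm{PSL}_2(\mathbb{R})^n$, the $j$-th components are the corresponding matrices with entry $x_j$. For lattices $L, L_1,L_2 \subset \mathbb{R}^n$: $\Gamma_{\mathrm{upp}}(L) = \{T^x : x \in L\}$, $\Gamma_{\mathrm{low}}(L) = \{V^y : y \in L\}$, and $\Gamma(L_1,L_2) \leq G$ is the subgroup generated by $\Gamma_{\mathrm{upp}}(L_1) \cup \Gamma_{\mathrm{low}}(L_2)$. *)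

theory Defs
  imports
    "HOL-Analysis.Analysis"
    "HOL-Algebra.Coset"
    "HOL-Algebra.Generated_Groups"
begin

section \<open>Free products of two groups\<close>

definition free_product_words :: "('a, 'c) monoid_scheme \<Rightarrow> ('b, 'd) monoid_scheme \<Rightarrow> ('a + 'b) list set"
  where "free_product_words G H = lists (carrier G <+> carrier H)"

text \<open>The smallest congruence on the monoid of words which identifies the product of two letters
  from the same factor with the corresponding letter, and the two units with the empty word.\<close>

inductive free_product_cong ::
  "('a, 'c) monoid_scheme \<Rightarrow> ('b, 'd) monoid_scheme \<Rightarrow> ('a + 'b) list \<Rightarrow> ('a + 'b) list \<Rightarrow> bool"
  for G and H where
    refl: "u \<in> free_product_words G H \<Longrightarrow> free_product_cong G H u u"
  | sym: "free_product_cong G H u v \<Longrightarrow> free_product_cong G H v u"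
  | trans: "free_product_cong G H u v \<Longrightarrow> free_product_cong G H v w \<Longrightarrow> free_product_cong G H u w"
  | append: "free_product_cong G H u u' \<Longrightarrow> free_product_cong G H v v' \<Longrightarrow>
      free_product_cong G H (u @ v) (u' @ v')"
  | one_left: "free_product_cong G H [Inl \<one>\<^bsub>G\<^esub>] []"
  | one_right: "free_product_cong G H [Inr \<one>\<^bsub>H\<^esub>] []"
  | mult_left: "x \<in> carrier G \<Longrightarrow> y \<in> carrier G \<Longrightarrow>
      free_product_cong G H [Inl x, Inl y] [Inl (x \<otimes>\<^bsub>G\<^esub> y)]"
  | mult_right: "x \<in> carrier H \<Longrightarrow> y \<in> carrier H \<Longrightarrow>
      free_product_cong G H [Inr x, Inr y] [Inr (x \<otimes>\<^bsub>H\<^esub> y)]"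

definition free_product_rel ::
  "('a, 'c) monoid_scheme \<Rightarrow> ('b, 'd) monoid_scheme \<Rightarrow> (('a + 'b) list \<times> ('a + 'b) list) set"
  where "free_product_rel G H = {(u, v). free_product_cong G H u v}"

definition free_product ::
  "('a, 'c) monoid_scheme \<Rightarrow> ('b, 'd) monoid_scheme \<Rightarrow> ('a + 'b) list set monoid"
  where "free_product G H =
    \<lparr> carrier = free_product_words G H // free_product_rel G H,
      mult = (\<lambda>A B. \<Union>u\<in>A. \<Union>v\<in>B. free_product_rel G H `` {u @ v}),
      one = free_product_rel G H `` {[]} \<rparr>"

definition free_product_eval ::
  "('c, 'e) monoid_scheme \<Rightarrow> ('a \<Rightarrow> 'c) \<Rightarrow> ('b \<Rightarrow> 'c) \<Rightarrow> ('a + 'b) list \<Rightarrow> 'c"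
  where "free_product_eval K f g w = foldr (\<lambda>l x. case_sum f g l \<otimes>\<^bsub>K\<^esub> x) w \<one>\<^bsub>K\<^esub>"

text \<open>The homomorphism on the free product induced by homomorphisms \<open>f\<close>, \<open>g\<close> on the factors;
  \<open>free_product_eval\<close> is constant on congruence classes of words.\<close>

definition free_product_lift ::
  "('c, 'e) monoid_scheme \<Rightarrow> ('a \<Rightarrow> 'c) \<Rightarrow> ('b \<Rightarrow> 'c) \<Rightarrow> ('a + 'b) list set \<Rightarrow> 'c"
  where "free_product_lift K f g A = the_elem (free_product_eval K f g ` A)"

definition free_inner_product :: "('a, 'b) monoid_scheme \<Rightarrow> 'a set \<Rightarrow> 'a set \<Rightarrow> bool"
  where "free_inner_product G A B \<longleftrightarrow>
    group G \<and> subgroup A G \<and> subgroup B G \<and>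
    free_product_lift G (\<lambda>x. x) (\<lambda>x. x)
      \<in> iso (free_product (G\<lparr>carrier := A\<rparr>) (G\<lparr>carrier := B\<rparr>)) G"

context
  fixes G :: "('a, 'c) monoid_scheme" and H :: "('b, 'd) monoid_scheme"
  assumes G: "group G" and H: "group H"
begin

interpretation G: group G by (rule G)
interpretation H: group H by (rule H)

lemma free_product_cong_words:
  "free_product_cong G H u v \<Longrightarrow> u \<in> free_product_words G H \<and> v \<in> free_product_words G H"
proof (induction rule: free_product_cong.induct)
  case refl then show ?case by simp
next case sym then show ?case by simp
next case trans then show ?case by simp
next case append then show ?case by (simp add: free_product_words_def)
next case one_left then show ?case by (auto simp: free_product_words_def)
next case one_right then show ?case by (auto simp: free_product_words_def)
next case mult_left then show ?case by (auto simp: free_product_words_def)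
next case mult_right then show ?case by (auto simp: free_product_words_def)
qed

lemma equiv_free_product_rel: "equiv (free_product_words G H) (free_product_rel G H)"
proof (rule equivI)
  show "free_product_rel G H \<subseteq> free_product_words G H \<times> free_product_words G H"
    unfolding free_product_rel_def using free_product_cong_words by blast
  show "refl_on (free_product_words G H) (free_product_rel G H)"
    unfolding free_product_rel_def by (rule refl_onI) (simp add: free_product_cong.refl)
  show "sym_on UNIV (free_product_rel G H)"
    unfolding free_product_rel_def by (rule symI) (simp add: free_product_cong.sym)
  show "trans_on UNIV (free_product_rel G H)"
    unfolding free_product_rel_def
    by (rule transI) (simp, rule free_product_cong.trans)
qed

lemma free_product_class_eq_iff:
  assumes "u \<in> free_product_words G H" "v \<in> free_product_words G H"
  shows "free_product_rel G H `` {u} = free_product_rel G H `` {v} \<longleftrightarrow> free_product_cong G H u v"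
  using eq_equiv_class_iff[OF equiv_free_product_rel assms] by (simp add: free_product_rel_def)

lemma free_product_carrierE:
  assumes "A \<in> carrier (free_product G H)"
  obtains u where "u \<in> free_product_words G H" "A = free_product_rel G H `` {u}"
  using assms by (auto simp: free_product_def elim: quotientE)

lemma free_product_class_closed:
  "u \<in> free_product_words G H \<Longrightarrow> free_product_rel G H `` {u} \<in> carrier (free_product G H)"
  by (auto simp: free_product_def intro: quotientI)

lemma free_product_words_append:
  "u \<in> free_product_words G H \<Longrightarrow> v \<in> free_product_words G H \<Longrightarrow> u @ v \<in> free_product_words G H"
  by (auto simp: free_product_words_def)

lemma free_product_mult_class:
  assumes u: "u \<in> free_product_words G H" and v: "v \<in> free_product_words G H"
  shows "free_product_rel G H `` {u} \<otimes>\<^bsub>free_product G H\<^esub> free_product_rel G H `` {v}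
    = free_product_rel G H `` {u @ v}"
proof -
  have eq: "free_product_rel G H `` {u' @ v'} = free_product_rel G H `` {u @ v}"
    if "free_product_cong G H u u'" "free_product_cong G H v v'" for u' v'
    using that free_product_cong_words[OF that(1)] free_product_cong_words[OF that(2)]
    by (simp add: free_product_class_eq_iff free_product_words_append free_product_cong.sym
        free_product_cong.append)
  have ru: "free_product_cong G H u u" "free_product_cong G H v v"
    using u v by (auto intro: free_product_cong.refl)
  have "free_product_rel G H `` {u} \<otimes>\<^bsub>free_product G H\<^esub> free_product_rel G H `` {v}
      = (\<Union>u'\<in>{u'. free_product_cong G H u u'}. \<Union>v'\<in>{v'. free_product_cong G H v v'}.
           free_product_rel G H `` {u' @ v'})"
    by (simp add: free_product_def free_product_rel_def Image_def)
  also have "\<dots> = (\<Union>u'\<in>{u'. free_product_cong G H u u'}. \<Union>v'\<in>{v'. free_product_cong G H v v'}.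
           free_product_rel G H `` {u @ v})"
    using eq by (intro SUP_cong refl) auto
  also have "\<dots> = free_product_rel G H `` {u @ v}"
    using ru by blast
  finally show ?thesis .
qed

lemma free_product_left_inverse:
  "u \<in> free_product_words G H \<Longrightarrow> \<exists>v\<in>free_product_words G H. free_product_cong G H (v @ u) []"
proof (induction u)
  case Nil
  then show ?case by (intro bexI[of _ "[]"]) (auto intro: free_product_cong.refl)
next
  case (Cons l u)
  then have u: "u \<in> free_product_words G H" and l: "l \<in> carrier G <+> carrier H"
    by (auto simp: free_product_words_def)
  obtain v where v: "v \<in> free_product_words G H" "free_product_cong G H (v @ u) []"
    using Cons.IH u by blast
  obtain k where k: "k \<in> carrier G <+> carrier H" "free_product_cong G H [k, l] []"
  proof (cases l)
    case (Inl x)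
    then have x: "x \<in> carrier G" using l by auto
    have "free_product_cong G H [Inl (inv\<^bsub>G\<^esub> x), Inl x] [Inl (inv\<^bsub>G\<^esub> x \<otimes>\<^bsub>G\<^esub> x)]"
      by (rule free_product_cong.mult_left) (use x in auto)
    then have "free_product_cong G H [Inl (inv\<^bsub>G\<^esub> x), Inl x] []"
      using x free_product_cong.one_left free_product_cong.trans by fastforce
    then show ?thesis using that[of "Inl (inv\<^bsub>G\<^esub> x)"] x Inl by auto
  next
    case (Inr x)
    then have x: "x \<in> carrier H" using l by auto
    have "free_product_cong G H [Inr (inv\<^bsub>H\<^esub> x), Inr x] [Inr (inv\<^bsub>H\<^esub> x \<otimes>\<^bsub>H\<^esub> x)]"
      by (rule free_product_cong.mult_right) (use x in auto)
    then have "free_product_cong G H [Inr (inv\<^bsub>H\<^esub> x), Inr x] []"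
      using x free_product_cong.one_right free_product_cong.trans by fastforce
    then show ?thesis using that[of "Inr (inv\<^bsub>H\<^esub> x)"] x Inr by auto
  qed
  have "free_product_cong G H ((v @ [k, l]) @ u) ((v @ []) @ u)"
    using v u k by (intro free_product_cong.append free_product_cong.refl)
  then have "free_product_cong G H ((v @ [k]) @ (l # u)) []"
    using v(2) free_product_cong.trans by fastforce
  moreover have "v @ [k] \<in> free_product_words G H"
    using v k by (auto simp: free_product_words_def)
  ultimately show ?case by blast
qed

lemma group_free_product: "group (free_product G H)"
proof (rule groupI)
  have nil: "[] \<in> free_product_words G H" by (simp add: free_product_words_def)
  have one: "\<one>\<^bsub>free_product G H\<^esub> = free_product_rel G H `` {[]}"
    by (simp add: free_product_def)
  show "\<one>\<^bsub>free_product G H\<^esub> \<in> carrier (free_product G H)"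
    using one free_product_class_closed[OF nil] by simp
  show "A \<otimes>\<^bsub>free_product G H\<^esub> B \<in> carrier (free_product G H)"
    if "A \<in> carrier (free_product G H)" "B \<in> carrier (free_product G H)" for A B
    using that by (metis free_product_carrierE free_product_mult_class free_product_words_append
        free_product_class_closed)
  show "\<one>\<^bsub>free_product G H\<^esub> \<otimes>\<^bsub>free_product G H\<^esub> A = A"
    if "A \<in> carrier (free_product G H)" for A
    using that by (metis free_product_carrierE free_product_mult_class nil one append_Nil)
  show "A \<otimes>\<^bsub>free_product G H\<^esub> B \<otimes>\<^bsub>free_product G H\<^esub> C
      = A \<otimes>\<^bsub>free_product G H\<^esub> (B \<otimes>\<^bsub>free_product G H\<^esub> C)"
    if A: "A \<in> carrier (free_product G H)" and B: "B \<in> carrier (free_product G H)"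
      and C: "C \<in> carrier (free_product G H)" for A B C
  proof -
    obtain u v w where "u \<in> free_product_words G H" "A = free_product_rel G H `` {u}"
      "v \<in> free_product_words G H" "B = free_product_rel G H `` {v}"
      "w \<in> free_product_words G H" "C = free_product_rel G H `` {w}"
      using A B C by (metis free_product_carrierE)
    then show ?thesis
      by (simp add: free_product_mult_class free_product_words_append)
  qed
  show "\<exists>B\<in>carrier (free_product G H). B \<otimes>\<^bsub>free_product G H\<^esub> A = \<one>\<^bsub>free_product G H\<^esub>"
    if A: "A \<in> carrier (free_product G H)" for A
  proof -
    obtain u where u: "u \<in> free_product_words G H" "A = free_product_rel G H `` {u}"
      using A by (metis free_product_carrierE)
    obtain v where v: "v \<in> free_product_words G H" "free_product_cong G H (v @ u) []"
      using free_product_left_inverse[OF u(1)] by blast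
    have "free_product_rel G H `` {v @ u} = free_product_rel G H `` {[]}"
      using v u nil by (subst free_product_class_eq_iff) (auto intro: free_product_words_append)
    then show ?thesis
      using u v one free_product_mult_class free_product_class_closed by metis
  qed
qed

context
  fixes K :: "('e, 'f) monoid_scheme" and f :: "'a \<Rightarrow> 'e" and g :: "'b \<Rightarrow> 'e"
  assumes K: "group K" and f: "f \<in> hom G K" and g: "g \<in> hom H K"
begin

interpretation K: group K by (rule K)

lemma letter_closed: "l \<in> carrier G <+> carrier H \<Longrightarrow> case_sum f g l \<in> carrier K"
  using f g by (auto simp: hom_def Pi_def)

lemma free_product_eval_closed:
  "u \<in> free_product_words G H \<Longrightarrow> free_product_eval K f g u \<in> carrier K"
proof (induction u)
  case Nil
  show ?case by (simp add: free_product_eval_def)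
next
  case (Cons l u)
  then have "u \<in> free_product_words G H" "l \<in> carrier G <+> carrier H"
    by (auto simp: free_product_words_def)
  then have "case_sum f g l \<otimes>\<^bsub>K\<^esub> free_product_eval K f g u \<in> carrier K"
    using Cons.IH letter_closed by (intro K.m_closed)
  then show ?case by (simp add: free_product_eval_def)
qed

lemma free_product_eval_append:
  assumes "u \<in> free_product_words G H" "v \<in> free_product_words G H"
  shows "free_product_eval K f g (u @ v) = free_product_eval K f g u \<otimes>\<^bsub>K\<^esub> free_product_eval K f g v"
  using assms(1)
proof (induction u)
  case Nil
  then show ?case using free_product_eval_closed[OF assms(2)] by (simp add: free_product_eval_def)
next
  case (Cons l u)
  then have u: "u \<in> free_product_words G H" and l: "l \<in> carrier G <+> carrier H"
    by (auto simp: free_product_words_def)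
  have cons: "free_product_eval K f g (l # w) = case_sum f g l \<otimes>\<^bsub>K\<^esub> free_product_eval K f g w" for w
    by (simp add: free_product_eval_def)
  show ?case
    using Cons.IH[OF u] letter_closed[OF l] free_product_eval_closed[OF u]
      free_product_eval_closed[OF assms(2)]
    by (simp only: append_Cons cons K.m_assoc)
qed

lemma free_product_eval_cong:
  "free_product_cong G H u v \<Longrightarrow> free_product_eval K f g u = free_product_eval K f g v"
proof (induction rule: free_product_cong.induct)
  case (append u u' v v')
  then show ?case
    using free_product_cong_words by (metis free_product_eval_append)
next
  case one_left
  then show ?case using hom_one[OF f G K] by (simp add: free_product_eval_def)
next
  case one_right
  then show ?case using hom_one[OF g H K] by (simp add: free_product_eval_def)
next
  case (mult_left x y)
  then show ?case using f by (auto simp: free_product_eval_def hom_def Pi_def K.m_assoc)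
next
  case (mult_right x y)
  then show ?case using g by (auto simp: free_product_eval_def hom_def Pi_def K.m_assoc)
qed auto

lemma free_product_lift_class:
  assumes "u \<in> free_product_words G H"
  shows "free_product_lift K f g (free_product_rel G H `` {u}) = free_product_eval K f g u"
proof -
  have "free_product_cong G H u u" by (rule free_product_cong.refl[OF assms])
  then have "free_product_eval K f g ` (free_product_rel G H `` {u}) = {free_product_eval K f g u}"
    unfolding free_product_rel_def by (auto dest: free_product_eval_cong intro: rev_image_eqI)
  then show ?thesis by (simp add: free_product_lift_def)
qed

lemma free_product_lift_hom: "free_product_lift K f g \<in> hom (free_product G H) K"
proof (rule homI)
  show "free_product_lift K f g A \<in> carrier K" if "A \<in> carrier (free_product G H)" for A
    using that by (metis free_product_carrierE free_product_lift_class free_product_eval_closed)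
  show "free_product_lift K f g (A \<otimes>\<^bsub>free_product G H\<^esub> B)
      = free_product_lift K f g A \<otimes>\<^bsub>K\<^esub> free_product_lift K f g B"
    if A: "A \<in> carrier (free_product G H)" and B: "B \<in> carrier (free_product G H)" for A B
  proof -
    obtain u v where "u \<in> free_product_words G H" "A = free_product_rel G H `` {u}"
      "v \<in> free_product_words G H" "B = free_product_rel G H `` {v}"
      using A B by (metis free_product_carrierE)
    then show ?thesis
      by (simp add: free_product_mult_class free_product_words_append free_product_lift_class
          free_product_eval_append)
  qed
qed

lemma free_product_lift_Inl:
  "x \<in> carrier G \<Longrightarrow> free_product_lift K f g (free_product_rel G H `` {[Inl x]}) = f x"
  using f by (subst free_product_lift_class)
    (auto simp: free_product_words_def free_product_eval_def hom_def Pi_def)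

lemma free_product_lift_Inr:
  "y \<in> carrier H \<Longrightarrow> free_product_lift K f g (free_product_rel G H `` {[Inr y]}) = g y"
  using g by (subst free_product_lift_class)
    (auto simp: free_product_words_def free_product_eval_def hom_def Pi_def)

end

end


section \<open>\<open>PSL\<^sub>2\<close> over a commutative ring\<close>

definition SL2 :: "(('a::comm_ring_1)^2^2) monoid"
  where "SL2 = \<lparr> carrier = {A. det A = 1}, mult = (**), one = mat 1 \<rparr>"

definition SL2_scalars :: "(('a::comm_ring_1)^2^2) set"
  where "SL2_scalars = {mat c | c. c * c = 1}"

text \<open>The scalar matrices of determinant one form the centre of \<open>SL2\<close>. For the ring
  \<open>real ^ 'n\<close> with componentwise operations these are the matrices \<open>mat c\<close> where every component
  of \<open>c\<close> is \<open>1\<close> or \<open>-1\<close>, so that \<open>PSL2\<close> over this ring is the \<open>n\<close>-fold power of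
  \<open>PSL2\<close> over the reals.\<close>

definition PSL2 :: "(('a::comm_ring_1)^2^2) set monoid"
  where "PSL2 = SL2 Mod SL2_scalars"

definition PSL2_class :: "('a::comm_ring_1)^2^2 \<Rightarrow> ('a^2^2) set"
  where "PSL2_class A = SL2_scalars #>\<^bsub>SL2\<^esub> A"

definition T_elt :: "'a::comm_ring_1 \<Rightarrow> ('a^2^2) set"
  where "T_elt x = PSL2_class (vector [vector [1, x], vector [0, 1]])"

definition V_elt :: "'a::comm_ring_1 \<Rightarrow> ('a^2^2) set"
  where "V_elt x = PSL2_class (vector [vector [1, 0], vector [x, 1]])"

definition Gamma_upp :: "('a::comm_ring_1) set \<Rightarrow> ('a^2^2) set set"
  where "Gamma_upp L = T_elt ` L"

definition Gamma_low :: "('a::comm_ring_1) set \<Rightarrow> ('a^2^2) set set"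
  where "Gamma_low L = V_elt ` L"

definition Gamma_gen :: "('a::comm_ring_1) set \<Rightarrow> 'a set \<Rightarrow> ('a^2^2) set monoid"
  where "Gamma_gen L1 L2 = PSL2 \<lparr> carrier := generate PSL2 (Gamma_upp L1 \<union> Gamma_low L2) \<rparr>"

lemmas mat2_simps = vec_eq_iff forall_2 matrix_matrix_mult_def sum_2 mat_def det_2

lemma group_SL2: "group (SL2 :: (('a::comm_ring_1)^2^2) monoid)"
proof (rule groupI)
  fix A :: "'a^2^2" assume A: "A \<in> carrier SL2"
  then show "\<exists>B\<in>carrier SL2. B \<otimes>\<^bsub>SL2\<^esub> A = \<one>\<^bsub>SL2\<^esub>"
    by (intro bexI[of _ "vector [vector [A$2$2, - A$1$2], vector [- A$2$1, A$1$1]]"])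
      (auto simp: SL2_def mat2_simps algebra_simps)
qed (auto simp: SL2_def det_mul matrix_mul_assoc)

lemma normal_SL2_scalars: "(SL2_scalars :: (('a::comm_ring_1)^2^2) set) \<lhd> SL2"
proof -
  interpret group "SL2 :: ('a^2^2) monoid" by (rule group_SL2)
  have comm: "mat c ** A = A ** mat c" for c and A :: "'a^2^2"
    by (simp add: mat2_simps algebra_simps)
  have mm: "mat c ** mat d = (mat (c * d) :: 'a^2^2)" for c d
    by (simp add: mat2_simps algebra_simps)
  have sub: "SL2_scalars \<subseteq> (carrier SL2 :: ('a^2^2) set)"
    by (auto simp: SL2_def SL2_scalars_def mat2_simps)
  have sg: "subgroup SL2_scalars (SL2 :: ('a^2^2) monoid)"
  proof (rule subgroupI)
    show "SL2_scalars \<noteq> ({} :: ('a^2^2) set)" by (auto simp: SL2_scalars_def intro: exI[of _ 1])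
    show "A \<otimes>\<^bsub>SL2\<^esub> B \<in> SL2_scalars" if "A \<in> SL2_scalars" "B \<in> SL2_scalars" for A B :: "'a^2^2"
    proof -
      obtain c d where cd: "A = mat c" "c * c = 1" "B = mat d" "d * d = 1"
        using \<open>A \<in> SL2_scalars\<close> \<open>B \<in> SL2_scalars\<close> by (auto simp: SL2_scalars_def)
      have "(c * d) * (c * d) = (c * c) * (d * d)" by (simp add: algebra_simps)
      then have "(c * d) * (c * d) = 1" using cd by simp
      then show ?thesis using cd unfolding SL2_scalars_def by (auto simp: SL2_def mm)
    qed
    show "inv\<^bsub>SL2\<^esub> A \<in> SL2_scalars" if A: "A \<in> SL2_scalars" for A :: "'a^2^2"
    proof -
      obtain c where "A = mat c" "c * c = 1" using A by (auto simp: SL2_scalars_def)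
      then have "A \<otimes>\<^bsub>SL2\<^esub> A = \<one>\<^bsub>SL2\<^esub>" by (simp add: SL2_def mm)
      then show ?thesis using A sub inv_equality[of A A] by auto
    qed
  qed (rule sub)
  show ?thesis
    by (rule normalI[OF sg])
      (auto simp: r_coset_def l_coset_def SL2_def SL2_scalars_def comm)
qed

lemma group_PSL2: "group (PSL2 :: (('a::comm_ring_1)^2^2) set monoid)"
  unfolding PSL2_def by (rule normal.factorgroup_is_group[OF normal_SL2_scalars])

lemma T_elt_V_elt_closed: "T_elt x \<in> carrier PSL2" "V_elt x \<in> carrier PSL2"
  unfolding T_elt_def V_elt_def PSL2_class_def PSL2_def FactGroup_def RCOSETS_def
  by (auto simp: SL2_def det_2 intro!: exI conjI)

lemma group_Gamma_gen: "group (Gamma_gen L1 L2)"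
  unfolding Gamma_gen_def
  by (intro group.subgroup_imp_group[OF group_PSL2] group.generate_is_subgroup[OF group_PSL2])
    (auto simp: Gamma_upp_def Gamma_low_def T_elt_V_elt_closed)


section \<open>Lattices and exponential series\<close>

definition full_lattice :: "(real^'n) set \<Rightarrow> bool"
  where "full_lattice L \<longleftrightarrow>
    (\<exists>B. independent B \<and> span B = UNIV \<and> L = {(\<Sum>b\<in>B. real_of_int (c b) *\<^sub>R b) | c. True})"

definition dual_lattice :: "(real^'n) set \<Rightarrow> (real^'n) set"
  where "dual_lattice L = {x. \<forall>y\<in>L. x \<bullet> y \<in> \<int>}"

definition nonneg_orthant :: "(real^'n) set"
  where "nonneg_orthant = {x. \<forall>j. 0 \<le> x $ j}"

definition upper_half_space :: "(complex^'n) set"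
  where "upper_half_space = {z. \<forall>j. 0 < Im (z $ j)}"

definition polynomial_growth :: "(real^'n) set \<Rightarrow> (real^'n \<Rightarrow> complex) \<Rightarrow> bool"
  where "polynomial_growth S a \<longleftrightarrow>
    (\<exists>C::real. \<exists>k::nat. \<forall>l\<in>S. norm (a l) \<le> C * (1 + norm l) ^ k)"

text \<open>For coefficients of polynomial growth, \<open>S\<close> the part of a lattice in the nonnegative
  orthant and \<open>z\<close> in \<open>upper_half_space\<close>, the family is absolutely summable, so \<open>infsum\<close> does
  not take its default value.\<close>

definition exp_series :: "(real^'n) set \<Rightarrow> (real^'n \<Rightarrow> complex) \<Rightarrow> complex^'n \<Rightarrow> complex"
  where "exp_series S a z =
    (\<Sum>\<^sub>\<infinity>l\<in>S. a l * exp (of_real pi * \<i> * (\<Sum>j\<in>UNIV. z $ j * of_real (l $ j))))"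

end

theory Submission
  imports Defs
begin

text \<open>Put \<open>\<phi>\<^sub>r(z) = exp (\<pi> i \<Sum>\<^sub>j z\<^sub>j r\<^sub>j\<^sup>2)\<close>. The series \<open>F\<close> is invariant under \<open>z \<mapsto> z + x\<close> for \<open>x \<in> L\<^sub>1\<close>, and the
  second summand \<open>\<phi>\<^sub>r - F\<close> of the functional equation is invariant under the slash action of \<open>V\<^sup>y\<close> for \<open>y \<in> L\<^sub>2\<close>.
  Hence for a word \<open>w = \<gamma>\<^sub>1 \<dots> \<gamma>\<^sub>m\<close> with suffixes \<open>w\<^sub>i = \<gamma>\<^sub>i \<dots> \<gamma>\<^sub>m\<close> the difference \<open>F|w - F\<close> telescopes to the sum of
  \<open>\<phi>\<^sub>r|w\<^sub>i - \<phi>\<^sub>r|w\<^sub>i\<^sub>+\<^sub>1\<close> over the lower triangular letters \<open>\<gamma>\<^sub>i\<close>. If \<open>w\<close> is a shortest nontrivial relator,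
  then \<open>F|w\<close> is a multiple of \<open>F\<close>, the proper suffixes are distinct in \<open>PSL\<^sub>2\<close>, and by alternation the
  suffix \<open>w\<^sub>2\<close> has a nonzero coefficient. For fixed \<open>z\<close> the functions \<open>r \<mapsto> \<phi>\<^sub>r(p)\<close> are
  characters in \<open>(r\<^sub>1\<^sup>2, \<dots>, r\<^sub>n\<^sup>2)\<close>, so they are independent for distinct points \<open>p\<close>. Comparing the expressions
  for \<open>F\<close> at \<open>z\<close> and at \<open>z + x\<close>, with \<open>x \<in> L\<^sub>1\<close> and \<open>z\<close> chosen so that \<open>w\<^sub>2 z\<close> is none of the points
  \<open>w\<^sub>i (z + x)\<close>, gives a contradiction.\<close>

section \<open>Shortest relators in free products\<close>

text \<open>Two neighbouring letters from one factor merge into their product, and the congruence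
  carries this through the surrounding word.\<close>

lemma free_product_not_alternating_shorten:
  assumes G: "group G" and H: "group H" and u: "u \<in> free_product_words G H"
    and "\<not> successively (\<lambda>k l. isl k \<noteq> isl l) u"
  shows "\<exists>v. free_product_cong G H u v \<and> length v < length u"
  using u assms(4)
proof (induction u rule: induct_list012)
  case (3 k l u)
  then have mem: "k \<in> carrier G <+> carrier H" "l \<in> carrier G <+> carrier H"
      "u \<in> free_product_words G H" "l # u \<in> free_product_words G H" "[k] \<in> free_product_words G H"
    by (auto simp: free_product_words_def)
  show ?case
  proof (cases "isl k = isl l")
    case True
    have "\<exists>m. free_product_cong G H [k, l] [m]"
      using True mem(1,2) by (auto intro: free_product_cong.mult_left free_product_cong.mult_right)
    then obtain m where "free_product_cong G H [k, l] [m]" by blast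
    then have "free_product_cong G H ([k, l] @ u) ([m] @ u)"
      by (intro free_product_cong.append free_product_cong.refl mem)
    then show ?thesis by force
  next
    case False
    then obtain v where v: "free_product_cong G H (l # u) v" "length v < length (l # u)"
      using 3 mem by auto
    have "free_product_cong G H ([k] @ (l # u)) ([k] @ v)"
      by (intro free_product_cong.append free_product_cong.refl mem v)
    then show ?thesis using v by (intro exI[of _ "k # v"]) auto
  qed
qed auto

text \<open>A shortest word that evaluates to the unit without being congruent to the empty word
  cannot be shortened, so it alternates between the factors and none of its proper subwords
  evaluates to the unit.\<close>

lemma free_inner_productI:
  fixes G (structure)
  assumes G: "group G" and A: "subgroup A G" and B: "subgroup B G"
    and gen: "carrier G \<subseteq> generate G (A \<union> B)"
    and no_relator: "\<And>u. u \<in> lists (A <+> B) \<Longrightarrow> length u \<ge> 2 \<Longrightarrow>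
      successively (\<lambda>k l. isl k \<noteq> isl l) u \<Longrightarrow>
      free_product_eval G (\<lambda>x. x) (\<lambda>x. x) u = \<one> \<Longrightarrow>
      (\<And>p v q. u = p @ v @ q \<Longrightarrow> v \<noteq> [] \<Longrightarrow> p @ q \<noteq> [] \<Longrightarrow>
        free_product_eval G (\<lambda>x. x) (\<lambda>x. x) v \<noteq> \<one>) \<Longrightarrow> False"
  shows "free_inner_product G A B"
proof -
  interpret G: group G by (rule G)
  let ?A = "G\<lparr>carrier := A\<rparr>" and ?B = "G\<lparr>carrier := B\<rparr>"
  let ?ev = "free_product_eval G (\<lambda>x. x) (\<lambda>x. x)" and ?lift = "free_product_lift G (\<lambda>x. x) (\<lambda>x. x)"
  have gA: "group ?A" and gB: "group ?B"
    using A B by (auto intro: G.subgroup_imp_group)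
  have hA: "(\<lambda>x. x) \<in> hom ?A G" and hB: "(\<lambda>x. x) \<in> hom ?B G"
    using subgroup.subset[OF A] subgroup.subset[OF B] by (auto simp: hom_def)
  note ctx = gA gB G hA hB
  have words: "free_product_words ?A ?B = lists (A <+> B)"
    by (simp add: free_product_words_def)
  have hom: "?lift \<in> hom (free_product ?A ?B) G"
    by (rule free_product_lift_hom[OF ctx])
  have trivial: "free_product_cong ?A ?B u []" if "u \<in> lists (A <+> B)" "?ev u = \<one>" for u
    using that
  proof (induction "length u" arbitrary: u rule: less_induct)
    case less
    note ev_cong = free_product_eval_cong[OF ctx] and cong_words = free_product_cong_words[OF gA gB]
    have reduce: "free_product_cong ?A ?B u []"
      if "free_product_cong ?A ?B u v" "length v < length u" for v
    proof -
      have "?ev v = \<one>" using ev_cong[OF that(1)] less.prems by simp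
      then have "free_product_cong ?A ?B v []"
        using less.hyps[OF that(2)] cong_words[OF that(1)] words by blast
      then show ?thesis using that(1) free_product_cong.trans by blast
    qed
    show ?case
    proof (rule ccontr)
      assume not: "\<not> free_product_cong ?A ?B u []"
      have alt: "successively (\<lambda>k l. isl k \<noteq> isl l) u"
        using free_product_not_alternating_shorten[OF gA gB, of u] less.prems not reduce words by blast
      \<comment> \<open>By induction such a subword is congruent to the empty word; cutting it out
        leaves a shorter word to which \<open>reduce\<close> applies.\<close>
      have sub: "?ev v \<noteq> \<one>" if "u = p @ v @ q" "v \<noteq> []" "p @ q \<noteq> []" for p v q
      proof
        assume "?ev v = \<one>"
        moreover have "length v < length u" using that by (cases p; cases q) auto
        moreover have mem: "p \<in> lists (A <+> B)" "v \<in> lists (A <+> B)" "q \<in> lists (A <+> B)"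
          using less.prems that by auto
        ultimately have "free_product_cong ?A ?B v []" using less.hyps by blast
        then have "free_product_cong ?A ?B (p @ v @ q) (p @ [] @ q)"
          using mem words by (intro free_product_cong.append free_product_cong.refl) auto
        then show False using reduce[of "p @ q"] not that by auto
      qed
      have "u \<noteq> []" using not words by (auto intro: free_product_cong.refl)
      \<comment> \<open>A single letter with value one is the unit of its factor, which the
        congruence deletes.\<close>
      moreover have "length u \<noteq> 1"
      proof
        assume "length u = 1"
        then obtain l where l: "u = [l]" by (cases u) auto
        then have "l = Inl \<one>\<^bsub>?A\<^esub> \<or> l = Inr \<one>\<^bsub>?B\<^esub>"
          using less.prems subgroup.subset[OF A] subgroup.subset[OF B]
          by (auto simp: free_product_eval_def)
        then show False using not l free_product_cong.one_left free_product_cong.one_right by blast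
      qed
      ultimately have "length u \<ge> 2" by (cases u) (auto simp: Suc_le_eq)
      then show False using no_relator less.prems alt sub by blast
    qed
  qed
  have gh: "group_hom (free_product ?A ?B) G ?lift"
    using hom G group_free_product[OF gA gB] by (simp add: group_hom_def group_hom_axioms_def)
  have "inj_on ?lift (carrier (free_product ?A ?B))"
    unfolding group_hom.inj_on_one_iff[OF gh]
  proof (intro allI impI)
    fix X assume X: "X \<in> carrier (free_product ?A ?B)" "?lift X = \<one>"
    obtain u where u: "u \<in> free_product_words ?A ?B" "X = free_product_rel ?A ?B `` {u}"
      using free_product_carrierE[OF gA gB X(1)] by blast
    then have "free_product_cong ?A ?B u []"
      using trivial X(2) free_product_lift_class[OF ctx] words by auto
    then have "X = free_product_rel ?A ?B `` {[]}"
      using u free_product_class_eq_iff[OF gA gB u(1), of "[]"] by (simp add: words)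
    then show "X = \<one>\<^bsub>free_product ?A ?B\<^esub>" by (simp add: free_product_def)
  qed
  moreover have "carrier G \<subseteq> ?lift ` carrier (free_product ?A ?B)"
  proof
    fix g assume "g \<in> carrier G"
    then have "g \<in> generate G (A \<union> B)" using gen by blast
    \<comment> \<open>Surjectivity: the image is a subgroup, and one-letter words show that it
      contains both factors.\<close>
    moreover have "generate G (A \<union> B) \<subseteq> ?lift ` carrier (free_product ?A ?B)"
    proof (rule G.generate_subgroup_incl)
      show "subgroup (?lift ` carrier (free_product ?A ?B)) G"
        by (rule group_hom.img_is_subgroup[OF gh])
      have "x = ?lift (free_product_rel ?A ?B `` {[Inl x]})" if "x \<in> A" for x
        using free_product_lift_Inl[OF ctx, of x] that by simp
      moreover have "x = ?lift (free_product_rel ?A ?B `` {[Inr x]})" if "x \<in> B" for x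
        using free_product_lift_Inr[OF ctx, of x] that by simp
      moreover have "free_product_rel ?A ?B `` {[Inl x]} \<in> carrier (free_product ?A ?B)" if "x \<in> A" for x
        using free_product_class_closed[OF gA gB, of "[Inl x]"] that words by auto
      moreover have "free_product_rel ?A ?B `` {[Inr x]} \<in> carrier (free_product ?A ?B)" if "x \<in> B" for x
        using free_product_class_closed[OF gA gB, of "[Inr x]"] that words by auto
      ultimately show "A \<union> B \<subseteq> ?lift ` carrier (free_product ?A ?B)" by blast
    qed
    ultimately show "g \<in> ?lift ` carrier (free_product ?A ?B)" by blast
  qed
  ultimately have "?lift \<in> iso (free_product ?A ?B) G"
    using hom by (auto simp: iso_def bij_betw_def hom_def)
  then show ?thesis
    using G A B by (simp add: free_inner_product_def)
qed

section \<open>Independence of the functions \<open>\<phi>\<^sub>r\<close>\<close>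

text \<open>Dedekind's argument for the independence of characters; only the distinguished character
  has to be different from the others.\<close>

lemma independent_characters:
  fixes X :: "'i \<Rightarrow> 'a::plus \<Rightarrow> 'f::field"
  assumes "finite I" "i\<^sub>0 \<notin> I"
    and "\<And>i u v. i \<in> insert i\<^sub>0 I \<Longrightarrow> u \<in> S \<Longrightarrow> v \<in> S \<Longrightarrow> X i (u + v) = X i u * X i v"
    and "\<And>u v. u \<in> S \<Longrightarrow> v \<in> S \<Longrightarrow> u + v \<in> S"
    and "u\<^sub>0 \<in> S" "X i\<^sub>0 u\<^sub>0 \<noteq> 0"
    and "\<And>i. i \<in> I \<Longrightarrow> \<exists>u\<in>S. X i u \<noteq> X i\<^sub>0 u"
    and "\<And>u. u \<in> S \<Longrightarrow> (\<Sum>i\<in>insert i\<^sub>0 I. c i * X i u) = 0"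
  shows "c i\<^sub>0 = 0"
  using assms(1-3,7,8)
proof (induction I arbitrary: c rule: finite_induct)
  case empty
  then show ?case using assms(5,6) by auto
next
  case (insert k I)
  obtain v where v: "v \<in> S" "X k v \<noteq> X i\<^sub>0 v" using insert.prems(3) by blast
  \<comment> \<open>Subtracting \<open>X k v\<close> times the relation at \<open>u\<close> from the
    relation at \<open>v + u\<close> removes index \<open>k\<close> and multiplies the coefficient
    of \<open>i\<^sub>0\<close> by the nonzero \<open>X i\<^sub>0 v - X k v\<close>.\<close>
  have "(\<Sum>i\<in>insert i\<^sub>0 I. (c i * (X i v - X k v)) * X i u) = 0" if u: "u \<in> S" for u
  proof -
    have "(\<Sum>i\<in>insert i\<^sub>0 I. (c i * (X i v - X k v)) * X i u)
        = (\<Sum>i\<in>insert i\<^sub>0 (insert k I). (c i * (X i v - X k v)) * X i u)"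
      using insert.hyps insert.prems(1) by (simp add: insert_commute)
    also have "\<dots> = (\<Sum>i\<in>insert i\<^sub>0 (insert k I). c i * X i (v + u) - X k v * (c i * X i u))"
    proof (intro sum.cong HOL.refl)
      fix i assume "i \<in> insert i\<^sub>0 (insert k I)"
      then have "X i (v + u) = X i v * X i u" using insert.prems(2) u v(1) by blast
      then show "c i * (X i v - X k v) * X i u = c i * X i (v + u) - X k v * (c i * X i u)"
        by (simp only: ring_distribs mult_ac)
    qed
    also have "\<dots> = (\<Sum>i\<in>insert i\<^sub>0 (insert k I). c i * X i (v + u))
        - X k v * (\<Sum>i\<in>insert i\<^sub>0 (insert k I). c i * X i u)"
      by (simp only: sum_subtractf sum_distrib_left)
    also have "\<dots> = 0"
      unfolding insert.prems(4)[OF u] insert.prems(4)[OF assms(4)[OF v(1) u]] by simp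
    finally show ?thesis .
  qed
  then have "c i\<^sub>0 * (X i\<^sub>0 v - X k v) = 0"
    by (rule insert.IH[where c = "\<lambda>i. c i * (X i v - X k v)", rotated 3]) (use insert.prems in auto)
  then show ?case using v by simp
qed

definition gauss :: "real^'n \<Rightarrow> complex^'n \<Rightarrow> complex"
  where "gauss r z = exp (of_real pi * \<i> * (\<Sum>j\<in>UNIV. z $ j * of_real ((r $ j)^2)))"

text \<open>Replacing \<open>(r $ j)^2\<close> by \<open>u $ j\<close> turns these functions into
  characters of the additive semigroup \<open>nonneg_orthant\<close>; square roots undo the
  substitution.\<close>

lemma independent_gauss:
  fixes P :: "'i \<Rightarrow> complex^'n"
  assumes I: "finite I" "i\<^sub>0 \<in> I"
    and P: "\<And>i. i \<in> I \<Longrightarrow> i \<noteq> i\<^sub>0 \<Longrightarrow> P i \<noteq> P i\<^sub>0"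
    and sum: "\<And>r. r \<in> nonneg_orthant \<Longrightarrow> (\<Sum>i\<in>I. c i * gauss r (P i)) = 0"
  shows "c i\<^sub>0 = 0"
proof -
  define X where "X i u = exp (of_real pi * \<i> * (\<Sum>j\<in>UNIV. P i $ j * of_real (u $ j)))"
    for i and u :: "real^'n"
  have eq: "insert i\<^sub>0 (I - {i\<^sub>0}) = I" using I by blast
  show ?thesis
  proof (rule independent_characters[where I = "I - {i\<^sub>0}" and X = X and S = nonneg_orthant and u\<^sub>0 = 0])
    show "X i (u + v) = X i u * X i v" for i u v
      by (simp add: X_def exp_add[symmetric] algebra_simps sum.distrib)
    show "\<exists>u\<in>nonneg_orthant. X i u \<noteq> X i\<^sub>0 u" if "i \<in> I - {i\<^sub>0}" for i
    proof -
      have "P i \<noteq> P i\<^sub>0" using P that by auto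
      then obtain j where j: "P i $ j \<noteq> P i\<^sub>0 $ j" by (auto simp: vec_eq_iff)
      define w where "w = P i $ j - P i\<^sub>0 $ j"
      \<comment> \<open>With this scaling the quotient of the two characters is \<open>exp\<close>
        of \<pi> i times a number of modulus one. Equality would make that number an even integer,
        which never has modulus one.\<close>
      define u :: "real^'n" where "u = axis j (1 / norm w)"
      have w: "w \<noteq> 0" using j by (simp add: w_def)
      have Xu: "X k u = exp (of_real pi * \<i> * (P k $ j / of_real (norm w)))" for k
      proof -
        have "(\<Sum>m\<in>UNIV. P k $ m * of_real (u $ m)) = (\<Sum>m\<in>UNIV. if m = j then P k $ j / of_real (norm w) else 0)"
          by (rule sum.cong) (auto simp: u_def axis_def)
        then show ?thesis by (simp add: X_def)
      qed
      have "X i u \<noteq> X i\<^sub>0 u"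
      proof
        assume "X i u = X i\<^sub>0 u"
        then have "exp (of_real pi * \<i> * (w / of_real (norm w))) = 1"
          by (simp add: Xu w_def exp_diff right_diff_distrib diff_divide_distrib)
        then obtain n :: int where n: "of_real pi * \<i> * (w / of_real (norm w)) = of_int (2 * n) * of_real pi * \<i>"
          unfolding exp_eq_1 by (auto simp: complex_eq_iff)
        then have "of_real pi * \<i> * (w / of_real (norm w) - of_int (2 * n)) = 0"
          by (simp add: algebra_simps)
        then have "w / of_real (norm w) = of_int (2 * n)" by simp
        then have "norm (of_int (2 * n) :: complex) = 1"
          using w by (metis norm_divide norm_of_real abs_norm_cancel divide_self norm_eq_zero)
        then have "\<bar>2 * n\<bar> = 1" by (simp only: norm_of_int)
        then show False by presburger
      qed
      moreover have "u \<in> nonneg_orthant" by (auto simp: u_def nonneg_orthant_def axis_def)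
      ultimately show ?thesis by blast
    qed
    show "(\<Sum>i\<in>insert i\<^sub>0 (I - {i\<^sub>0}). c i * X i u) = 0" if "u \<in> nonneg_orthant" for u
    proof -
      have "gauss (\<chi> j. sqrt (u $ j)) (P i) = X i u" for i
        using that by (simp add: gauss_def X_def nonneg_orthant_def)
      moreover have "(\<chi> j. sqrt (u $ j)) \<in> nonneg_orthant"
        using that by (simp add: nonneg_orthant_def)
      ultimately show ?thesis using sum[of "\<chi> j. sqrt (u $ j)"] eq by simp
    qed
    show "u + v \<in> nonneg_orthant" if "u \<in> nonneg_orthant" "v \<in> nonneg_orthant" for u v :: "real^'n"
      using that by (simp add: nonneg_orthant_def)
    show "0 \<in> (nonneg_orthant :: (real^'n) set)" by (simp add: nonneg_orthant_def)
    show "X i\<^sub>0 0 \<noteq> 0" by (simp add: X_def)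
  qed (use I in simp_all)
qed

section \<open>Moebius action of \<open>PSL\<^sub>2\<close>\<close>

definition upp_mat :: "'a::comm_ring_1 \<Rightarrow> 'a^2^2"
  where "upp_mat x = vector [vector [1, x], vector [0, 1]]"

definition low_mat :: "'a::comm_ring_1 \<Rightarrow> 'a^2^2"
  where "low_mat y = vector [vector [1, 0], vector [y, 1]]"

lemma PSL2_class_mult:
  fixes A B :: "('a::comm_ring_1)^2^2"
  assumes "det A = 1" "det B = 1"
  shows "PSL2_class (A ** B) = PSL2_class A \<otimes>\<^bsub>PSL2\<^esub> PSL2_class B"
proof -
  have "(SL2_scalars #>\<^bsub>SL2\<^esub> A) <#>\<^bsub>SL2\<^esub> (SL2_scalars #>\<^bsub>SL2\<^esub> B) = SL2_scalars #>\<^bsub>SL2\<^esub> (A \<otimes>\<^bsub>SL2\<^esub> B)"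
    by (rule normal.rcos_sum[OF normal_SL2_scalars]) (use assms in \<open>auto simp: SL2_def\<close>)
  then show ?thesis by (simp add: PSL2_class_def PSL2_def FactGroup_def) (simp add: SL2_def)
qed

lemma PSL2_class_one: "PSL2_class (mat 1) = \<one>\<^bsub>PSL2\<^esub>"
proof -
  interpret normal SL2_scalars "SL2 :: (('a::comm_ring_1)^2^2) monoid" by (rule normal_SL2_scalars)
  have "SL2_scalars #>\<^bsub>SL2\<^esub> \<one>\<^bsub>SL2 :: ('a^2^2) monoid\<^esub> = SL2_scalars"
    by (rule coset_mult_one) (rule subset)
  then show ?thesis by (simp add: PSL2_class_def PSL2_def FactGroup_def) (simp add: SL2_def)
qed

lemma PSL2_class_closed: "det A = 1 \<Longrightarrow> PSL2_class A \<in> carrier PSL2"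
  by (auto simp: PSL2_class_def PSL2_def FactGroup_def RCOSETS_def SL2_def)

lemma PSL2_class_eq_iff:
  fixes A B :: "('a::comm_ring_1)^2^2"
  assumes "det A = 1" "det B = 1"
  shows "PSL2_class A = PSL2_class B \<longleftrightarrow> (\<exists>c. c * c = 1 \<and> A = mat c ** B)"
proof -
  interpret normal SL2_scalars "SL2 :: ('a^2^2) monoid" by (rule normal_SL2_scalars)
  have mem: "A \<in> carrier SL2" "B \<in> carrier SL2" using assms by (auto simp: SL2_def)
  have "PSL2_class A = PSL2_class B \<longleftrightarrow> A \<in> SL2_scalars #>\<^bsub>SL2\<^esub> B"
    unfolding PSL2_class_def using mem
    by (metis repr_independence rcos_self is_subgroup)
  also have "\<dots> \<longleftrightarrow> (\<exists>c. c * c = 1 \<and> A = mat c ** B)"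
    by (auto simp: r_coset_def SL2_scalars_def SL2_def)
  finally show ?thesis .
qed

lemma det_upp_mat [simp]: "det (upp_mat x) = 1" and det_low_mat [simp]: "det (low_mat x) = 1"
  by (simp_all add: upp_mat_def low_mat_def det_2)

lemma upp_mat_add: "upp_mat (x + y) = upp_mat x ** upp_mat y"
  and low_mat_add: "low_mat (x + y) = low_mat x ** low_mat y"
  by (simp_all add: upp_mat_def low_mat_def mat2_simps algebra_simps)

lemma T_elt_class: "T_elt x = PSL2_class (upp_mat x)" and V_elt_class: "V_elt x = PSL2_class (low_mat x)"
  by (simp_all add: T_elt_def V_elt_def upp_mat_def low_mat_def)

lemma T_elt_add: "T_elt (x + y) = T_elt x \<otimes>\<^bsub>PSL2\<^esub> T_elt y"
  and V_elt_add: "V_elt (x + y) = V_elt x \<otimes>\<^bsub>PSL2\<^esub> V_elt y"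
  by (simp_all add: T_elt_class V_elt_class upp_mat_add low_mat_add PSL2_class_mult)

text \<open>The diagonal entries force the scalar to be one. Thus an infinite set of translations
  gives infinitely many group elements.\<close>

lemma inj_T_elt: "inj T_elt"
proof (rule injI)
  fix x y :: 'a assume "T_elt x = T_elt y"
  then obtain c where "upp_mat x = mat c ** upp_mat y"
    by (auto simp: T_elt_class PSL2_class_eq_iff)
  then show "x = y" by (auto simp: upp_mat_def mat2_simps)
qed

lemma subgroup_image_additive:
  fixes G (structure) and h :: "'a::ab_group_add \<Rightarrow> _"
  assumes "group G" and "\<And>x. h x \<in> carrier G" "\<And>x y. h (x + y) = h x \<otimes> h y"
    and "0 \<in> L" "\<And>x y. x \<in> L \<Longrightarrow> y \<in> L \<Longrightarrow> x + y \<in> L" "\<And>x. x \<in> L \<Longrightarrow> - x \<in> L"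
  shows "subgroup (h ` L) G"
proof -
  interpret group G by fact
  have h0: "h 0 = \<one>" using assms(3)[of 0 0] assms(2)[of 0] by (metis add_0 r_cancel_one')
  have inv: "inv (h x) = h (- x)" for x
    using assms(3)[of "- x" x] assms(2) h0 by (intro inv_equality) auto
  show ?thesis
    by (rule subgroupI) (use assms in \<open>auto simp: inv assms(3)[symmetric]\<close>)
qed

section \<open>Words of lattice vectors as matrix products\<close>

definition letter_mat :: "'a::comm_ring_1 + 'a \<Rightarrow> 'a^2^2"
  where "letter_mat = case_sum upp_mat low_mat"

definition word_mat :: "('a::comm_ring_1 + 'a) list \<Rightarrow> 'a^2^2"
  where "word_mat us = foldr (\<lambda>l A. letter_mat l ** A) us (mat 1)"

lemma word_mat_simps [simp]:
  "word_mat [] = mat 1" "word_mat (l # us) = letter_mat l ** word_mat us"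
  by (simp_all add: word_mat_def)

lemma det_letter_mat [simp]: "det (letter_mat l) = 1"
  by (simp add: letter_mat_def split: sum.split)

lemma det_word_mat [simp]: "det (word_mat us) = 1"
  by (induction us) (auto simp: det_mul)

text \<open>Words of vectors keep a matrix representative at hand, on which the action and the
  automorphy factors can be computed letter by letter.\<close>

lemma free_product_eval_elts:
  "free_product_eval (Gamma_gen L M) (\<lambda>x. x) (\<lambda>x. x) (map (map_sum T_elt V_elt) us) = PSL2_class (word_mat us)"
proof (induction us)
  case (Cons l us)
  then show ?case
    by (cases l) (auto simp: free_product_eval_def Gamma_gen_def PSL2_class_mult letter_mat_def
        T_elt_class V_elt_class)
qed (simp add: free_product_eval_def Gamma_gen_def PSL2_class_one)

lemma word_mat_append: "word_mat (us @ vs) = word_mat us ** word_mat vs"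
  by (induction us) (auto simp: matrix_mul_assoc)

section \<open>Componentwise fractional linear action on the product of upper half planes\<close>

definition moebius_act :: "(real^'n)^2^2 \<Rightarrow> complex^'n \<Rightarrow> complex^'n"
  where "moebius_act A z = (\<chi> j. (of_real (A $ 1 $ 1 $ j) * z $ j + of_real (A $ 1 $ 2 $ j))
    / (of_real (A $ 2 $ 1 $ j) * z $ j + of_real (A $ 2 $ 2 $ j)))"

lemma det2_nth:
  fixes A :: "(real^'n)^2^2"
  assumes "det A = 1"
  shows "A $ 1 $ 1 $ j * A $ 2 $ 2 $ j - A $ 1 $ 2 $ j * A $ 2 $ 1 $ j = 1"
  using arg_cong[OF assms, of "\<lambda>v. v $ j"] by (simp add: det_2)

lemma moebius_denominator_nonzero:
  fixes A :: "(real^'n)^2^2"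
  assumes "det A = 1" "z \<in> upper_half_space"
  shows "of_real (A $ 2 $ 1 $ j) * z $ j + of_real (A $ 2 $ 2 $ j) \<noteq> 0"
proof
  assume "of_real (A $ 2 $ 1 $ j) * z $ j + of_real (A $ 2 $ 2 $ j) = 0"
  then have eqs: "A $ 2 $ 1 $ j * Re (z $ j) + A $ 2 $ 2 $ j = 0" "A $ 2 $ 1 $ j * Im (z $ j) = 0"
    by (auto simp: complex_eq_iff)
  moreover have "Im (z $ j) > 0" using assms by (auto simp: upper_half_space_def)
  ultimately have "A $ 2 $ 1 $ j = 0" "A $ 2 $ 2 $ j = 0" by auto
  then show False using det2_nth[OF assms(1), of j] by simp
qed

lemma moebius_upper_half_space:
  fixes A :: "(real^'n)^2^2"
  assumes "det A = 1" "z \<in> upper_half_space"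
  shows "moebius_act A z \<in> upper_half_space"
proof -
  have "0 < Im (moebius_act A z $ j)" for j
  proof -
    define a b c d w where "a = A $ 1 $ 1 $ j" "b = A $ 1 $ 2 $ j" "c = A $ 2 $ 1 $ j" "d = A $ 2 $ 2 $ j" "w = z $ j"
    note defs = this
    let ?n = "of_real a * w + of_real b" and ?d = "of_real c * w + of_real d :: complex"
    have d0: "?d \<noteq> 0" using moebius_denominator_nonzero[OF assms, of j] by (simp add: defs)
    have det: "a * d - b * c = 1" using det2_nth[OF assms(1)] by (simp add: defs)
    have "Im (?n * cnj ?d) = (a * d - b * c) * Im w" by (simp add: algebra_simps)
    then have "Im (?n * cnj ?d) > 0" using det assms(2) by (simp add: defs upper_half_space_def)
    moreover have "Im (?n / ?d) = Im (?n * cnj ?d) / (norm ?d)^2"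
      unfolding complex_div_cnj[of ?n ?d] by (metis Im_divide_of_real of_real_power)
    ultimately show ?thesis using d0 by (simp add: moebius_act_def defs)
  qed
  then show ?thesis by (simp add: upper_half_space_def)
qed

lemma moebius_mult:
  fixes A B :: "(real^'n)^2^2"
  assumes "det A = 1" "det B = 1" "z \<in> upper_half_space"
  shows "moebius_act (A ** B) z = moebius_act A (moebius_act B z)"
proof -
  have "moebius_act (A ** B) z $ j = moebius_act A (moebius_act B z) $ j" for j
  proof -
    have "of_real (B $ 2 $ 1 $ j) * z $ j + of_real (B $ 2 $ 2 $ j) \<noteq> (0::complex)"
      by (rule moebius_denominator_nonzero[OF assms(2,3)])
    then show ?thesis
      using moebius_denominator_nonzero[OF assms(1) moebius_upper_half_space[OF assms(2,3)], of j]
        moebius_denominator_nonzero[of "A ** B" z j] assms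
      by (simp add: moebius_act_def matrix_matrix_mult_def sum_2 det_mul divide_simps) (simp add: algebra_simps)
  qed
  then show ?thesis by (simp add: vec_eq_iff)
qed

lemma moebius_one [simp]: "moebius_act (mat 1) z = z"
  by (simp add: moebius_act_def mat_def vec_eq_iff)

lemma moebius_PSL2_class:
  fixes A B :: "(real^'n)^2^2"
  assumes "det A = 1" "det B = 1" "PSL2_class A = PSL2_class B"
  shows "moebius_act A z = moebius_act B z"
proof -
  obtain c where c: "c * c = 1" "A = mat c ** B" using assms PSL2_class_eq_iff by blast
  have "c $ j \<noteq> 0" for j using arg_cong[OF c(1), of "\<lambda>v. v $ j"] by auto
  then have "moebius_act A z $ j = moebius_act B z $ j" for j
    by (simp add: moebius_act_def c(2) matrix_matrix_mult_def sum_2 mat_def mult.assoc flip: distrib_left)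
  then show ?thesis by (simp add: vec_eq_iff)
qed

text \<open>The three equations say that the quadratic
  \<open>(a*z + b) * (c'*z + d') - (a'*z + b') * (c*z + d)\<close> vanishes identically, so both
  matrices give the same Moebius map.\<close>

lemma SL2_real_eq_sign:
  fixes a b c d a' b' c' d' :: real
  assumes det: "a * d - b * c = 1" "a' * d' - b' * c' = 1"
    and "a * c' = a' * c" "a * d' + b * c' = a' * d + b' * c" "b * d' = b' * d"
  shows "\<exists>s. s * s = 1 \<and> a = s * a' \<and> b = s * b' \<and> c = s * c' \<and> d = s * d'"
\<comment> \<open>If the first matrix is \<open>s\<close> times the second, then
  \<open>a * d' - b' * c = s * (a' * d' - b' * c') = s\<close>.\<close>
proof (intro exI[of _ "a * d' - b' * c"] conjI)
  show "a = (a * d' - b' * c) * a'" using assms by algebra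
  show "b = (a * d' - b' * c) * b'" using assms by algebra
  show "c = (a * d' - b' * c) * c'" using assms by algebra
  show "d = (a * d' - b' * c) * d'" using assms by algebra
  show "(a * d' - b' * c) * (a * d' - b' * c) = 1" using assms by algebra
qed

text \<open>Two matrices that differ in \<open>PSL2\<close> differ in some component, where their actions agree
  only at the roots of a nonzero quadratic polynomial.\<close>

lemma exists_separating_point:
  fixes S :: "((real^'n)^2^2) set"
  assumes "finite S" and det: "\<And>A. A \<in> S \<Longrightarrow> det A = 1"
  shows "\<exists>z\<in>upper_half_space. \<forall>A\<in>S. \<forall>B\<in>S.
    moebius_act A z = moebius_act B z \<longrightarrow> PSL2_class A = PSL2_class B"
proof -
  \<comment> \<open>Cross-multiplying the equality of the \<open>j\<close>-th components of the two
    actions gives this quadratic in \<open>z $ j\<close>.\<close>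
  define q where "q A B j = [:of_real (A $ 1 $ 2 $ j * B $ 2 $ 2 $ j - B $ 1 $ 2 $ j * A $ 2 $ 2 $ j),
      of_real (A $ 1 $ 1 $ j * B $ 2 $ 2 $ j + A $ 1 $ 2 $ j * B $ 2 $ 1 $ j
        - B $ 1 $ 1 $ j * A $ 2 $ 2 $ j - B $ 1 $ 2 $ j * A $ 2 $ 1 $ j),
      of_real (A $ 1 $ 1 $ j * B $ 2 $ 1 $ j - B $ 1 $ 1 $ j * A $ 2 $ 1 $ j) :: complex:]"
    for A B :: "(real^'n)^2^2" and j
  \<comment> \<open>A zero polynomial excludes no point: there the components of \<open>A\<close>
    and \<open>B\<close> agree up to sign. So \<open>bad j\<close> stays finite.\<close>
  define bad where "bad j = (\<Union>A\<in>S. \<Union>B\<in>S. if q A B j = 0 then {} else {w. poly (q A B j) w = 0})" for j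
  have "finite (bad j)" for j
    using \<open>finite S\<close> by (auto simp: bad_def poly_roots_finite)
  moreover have "infinite {w. 0 < Im w}"
  proof -
    have "range (\<lambda>n. \<i> * of_nat (Suc n)) \<subseteq> {w. 0 < Im w}" by auto
    moreover have "inj (\<lambda>n. \<i> * of_nat (Suc n))" by (auto simp: inj_def)
    ultimately show ?thesis using range_inj_infinite infinite_super by blast
  qed
  ultimately have "\<exists>w. 0 < Im w \<and> w \<notin> bad j" for j
    by (metis (mono_tags, lifting) finite_subset mem_Collect_eq subsetI)
  then obtain f where f: "\<And>j. 0 < Im (f j) \<and> f j \<notin> bad j" by metis
  define z where "z = (\<chi> j. f j)"
  have z: "z \<in> upper_half_space" using f by (simp add: z_def upper_half_space_def)
  have "PSL2_class A = PSL2_class B" if AB: "A \<in> S" "B \<in> S" "moebius_act A z = moebius_act B z" for A B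
  proof -
    have "\<exists>s. s * s = 1 \<and> A $ 1 $ 1 $ j = s * B $ 1 $ 1 $ j \<and> A $ 1 $ 2 $ j = s * B $ 1 $ 2 $ j
        \<and> A $ 2 $ 1 $ j = s * B $ 2 $ 1 $ j \<and> A $ 2 $ 2 $ j = s * B $ 2 $ 2 $ j" for j
    proof -
      have "poly (q A B j) (f j) = 0"
        using arg_cong[OF AB(3), of "\<lambda>v. v $ j"] moebius_denominator_nonzero[OF det[OF AB(1)] z, of j]
          moebius_denominator_nonzero[OF det[OF AB(2)] z, of j]
        by (simp add: moebius_act_def q_def z_def frac_eq_eq algebra_simps power2_eq_square)
      then have "q A B j = 0" using f[of j] AB by (auto simp: bad_def split: if_splits)
      then show ?thesis
        using det2_nth[OF det[OF AB(1)], of j] det2_nth[OF det[OF AB(2)], of j]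
        by (intro SL2_real_eq_sign) (auto simp: q_def simp flip: of_real_mult of_real_add of_real_diff)
    qed
    \<comment> \<open>The signs may vary with the component; together they form a vector of square
      one, exactly a scalar divided out in \<open>PSL2\<close>.\<close>
    then obtain s where s: "\<And>j. s j * s j = 1 \<and> A $ 1 $ 1 $ j = s j * B $ 1 $ 1 $ j
        \<and> A $ 1 $ 2 $ j = s j * B $ 1 $ 2 $ j
        \<and> A $ 2 $ 1 $ j = s j * B $ 2 $ 1 $ j \<and> A $ 2 $ 2 $ j = s j * B $ 2 $ 2 $ j" by metis
    then have "(\<chi> j. s j) * (\<chi> j. s j) = 1" "A = mat (\<chi> j. s j) ** B"
      by (simp_all add: vec_eq_iff forall_2 matrix_matrix_mult_def sum_2 mat_def)
    then show ?thesis
      using det AB by (subst PSL2_class_eq_iff) auto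
  qed
  then show ?thesis using z by blast
qed

section \<open>Lattice periodicity\<close>

lemma dual_lattice_closed:
  "0 \<in> dual_lattice L" "x \<in> dual_lattice L \<Longrightarrow> y \<in> dual_lattice L \<Longrightarrow> x + y \<in> dual_lattice L"
  "x \<in> dual_lattice L \<Longrightarrow> - x \<in> dual_lattice L"
  by (auto simp: dual_lattice_def inner_add_left)

text \<open>The coordinate functional at a basis vector is integral on the lattice, so the nonzero
  vector representing it and all its natural multiples lie in the dual.\<close>

lemma infinite_dual_lattice:
  fixes L :: "(real^'n) set"
  assumes "full_lattice L"
  shows "infinite (dual_lattice L)"
proof -
  obtain B where B: "independent B" "span B = UNIV"
    and L: "L = {(\<Sum>b\<in>B. real_of_int (c b) *\<^sub>R b) | c. True}"
    using assms by (auto simp: full_lattice_def)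
  have "B \<noteq> {}" using B(2) by (metis UNIV_eq_I singletonD span_empty zero_neq_one UNIV_I)
  then obtain b0 where b0: "b0 \<in> B" by blast
  obtain f :: "real^'n \<Rightarrow> real" where f: "linear f" "\<And>b. b \<in> B \<Longrightarrow> f b = (if b = b0 then 1 else 0)"
    using linear_independent_extend[OF B(1), of "\<lambda>b. if b = b0 then 1 else 0"] by blast
  \<comment> \<open>The vector that represents the functional \<open>f\<close> through the inner
    product.\<close>
  define w where "w = adjoint f 1"
  have fw: "w \<bullet> x = f x" for x
    using adjoint_works[OF f(1), of x 1] by (simp add: w_def inner_commute)
  have "f x \<in> \<int>" if "x \<in> L" for x
  proof -
    obtain c where c: "x = (\<Sum>b\<in>B. real_of_int (c b) *\<^sub>R b)" using \<open>x \<in> L\<close> L by blast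
    have "f x = (\<Sum>b\<in>B. real_of_int (c b) * f b)"
      by (simp add: c linear_sum[OF f(1)] linear_cmul[OF f(1)])
    then show ?thesis using f(2) by (auto intro!: Ints_sum)
  qed
  then have "range (\<lambda>k::nat. of_nat k *\<^sub>R w) \<subseteq> dual_lattice L"
    by (auto simp: dual_lattice_def fw)
  moreover have "w \<noteq> 0" using f(2)[OF b0] fw[of b0] by auto
  then have "inj (\<lambda>k::nat. of_nat k *\<^sub>R w)" by (auto simp: inj_def)
  ultimately show ?thesis using range_inj_infinite infinite_super by blast
qed

text \<open>The shift by \<open>2 * x\<close> adds \<pi> i times \<open>2 * (x \<bullet> l)\<close>
  to the exponent, an integral multiple of 2 \<pi> i, so every single term is unchanged.\<close>

lemma exp_series_periodic:
  fixes L :: "(real^'n) set"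
  assumes "x \<in> dual_lattice L" "S \<subseteq> L"
  shows "exp_series S a (z + (\<chi> j. of_real (2 * x $ j))) = exp_series S a z"
proof -
  have "exp (of_real pi * \<i> * (\<Sum>j\<in>UNIV. (z + (\<chi> j. of_real (2 * x $ j))) $ j * of_real (l $ j)))
      = exp (of_real pi * \<i> * (\<Sum>j\<in>UNIV. z $ j * of_real (l $ j)))" if "l \<in> S" for l
  proof -
    have "x \<bullet> l \<in> \<int>" using assms that by (auto simp: dual_lattice_def)
    then obtain n where n: "x \<bullet> l = of_int n" by (auto elim: Ints_cases)
    have "(\<Sum>j\<in>UNIV. (z + (\<chi> j. of_real (2 * x $ j))) $ j * of_real (l $ j))
        = (\<Sum>j\<in>UNIV. z $ j * of_real (l $ j)) + of_real (2 * (x \<bullet> l))"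
      by (simp add: inner_vec_def algebra_simps sum.distrib sum_distrib_left)
    then show ?thesis
      using exp_integer_2pi[of "of_int n"]
      by (simp add: n ring_distribs exp_add mult_ac)
  qed
  then show ?thesis by (simp add: exp_series_def cong: infsum_cong)
qed

section \<open>The telescoping argument\<close>

text \<open>The quotient of values of \<open>s\<close> makes invariance of \<open>h / s\<close>
  under a lower letter the same as invariance of \<open>h\<close> under the slash action.\<close>

definition automorphy_factor :: "(complex^'n \<Rightarrow> complex) \<Rightarrow> (real^'n) + (real^'n) \<Rightarrow> complex^'n \<Rightarrow> complex"
  where "automorphy_factor s l z =
    (case l of Inl x \<Rightarrow> 1 | Inr y \<Rightarrow> s z / s (moebius_act (low_mat y) z))"

text \<open>The automorphy factor of a word for the right action \<open>(f | \<gamma>) z = j(\<gamma>, z) f(\<gamma> z)\<close> on functions, so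
  that the first letter is applied first to functions and last to points.\<close>

fun cocycle :: "(complex^'n \<Rightarrow> complex) \<Rightarrow> ((real^'n) + (real^'n)) list \<Rightarrow> complex^'n \<Rightarrow> complex"
  where "cocycle s [] z = 1"
  | "cocycle s (l # us) z = cocycle s us z * automorphy_factor s l (moebius_act (word_mat us) z)"

lemma moebius_act_word:
  "z \<in> upper_half_space \<Longrightarrow> moebius_act (word_mat us) z \<in> upper_half_space"
  by (rule moebius_upper_half_space) simp_all

lemma cocycle_nonzero:
  assumes "\<And>w. w \<in> upper_half_space \<Longrightarrow> s w \<noteq> 0" "z \<in> upper_half_space"
  shows "cocycle s us z \<noteq> 0"
  by (induction us) (auto simp: automorphy_factor_def assms moebius_act_word moebius_upper_half_space split: sum.split)

text \<open>In the telescoping sum over suffixes each letter from the second factor contributes \<open>1\<close> at the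
  suffix that starts with it and \<open>-1\<close> at the next one.\<close>

definition suffix_sign :: "('a + 'b) list \<Rightarrow> nat \<Rightarrow> complex"
  where "suffix_sign us i = of_bool (i < length us \<and> \<not> isl (us ! i)) - of_bool (0 < i \<and> \<not> isl (us ! (i - 1)))"

text \<open>Prepending an upper letter leaves the left side unchanged. For a lower letter,
  invariance of \<open>\<phi> - F\<close> turns the increment of \<open>F\<close> into that of
  \<open>\<phi>\<close>.\<close>

lemma cocycle_telescope:
  fixes us :: "((real^'n) + (real^'n)) list"
  assumes s: "\<And>w. w \<in> upper_half_space \<Longrightarrow> s w \<noteq> 0"
    and upp: "\<And>x w. Inl x \<in> set us \<Longrightarrow> w \<in> upper_half_space \<Longrightarrow> F (moebius_act (upp_mat x) w) = F w"
    and low: "\<And>y w. Inr y \<in> set us \<Longrightarrow> w \<in> upper_half_space \<Longrightarrow>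
      (\<phi> (moebius_act (low_mat y) w) - F (moebius_act (low_mat y) w)) / s (moebius_act (low_mat y) w)
        = (\<phi> w - F w) / s w"
    and z: "z \<in> upper_half_space"
  shows "cocycle s us z * F (moebius_act (word_mat us) z) - F z
    = (\<Sum>i\<le>length us. suffix_sign us i * cocycle s (drop i us) z * \<phi> (moebius_act (word_mat (drop i us)) z))"
  using upp low
proof (induction us)
  case Nil
  then show ?case by (simp add: suffix_sign_def)
next
  case (Cons l us)
  define w where "w = moebius_act (word_mat us) z"
  define g where "g i = cocycle s (drop i us) z * \<phi> (moebius_act (word_mat (drop i us)) z)" for i
  define b where "b = (of_bool (\<not> isl l) :: complex)"
  have w: "w \<in> upper_half_space" unfolding w_def by (rule moebius_act_word[OF z])
  have act: "moebius_act (word_mat (l # us)) z = moebius_act (letter_mat l) w"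
    by (simp add: w_def moebius_mult z)
  have IH: "cocycle s us z * F w - F z = (\<Sum>i\<le>length us. suffix_sign us i * g i)"
    using Cons by (simp add: w_def g_def mult.assoc)
  \<comment> \<open>Prepending \<open>l\<close> shifts all indices by one; only the old index
    \<open>0\<close> acquires a predecessor, and with it the term \<open>-b\<close>.\<close>
  have sign: "suffix_sign (l # us) (Suc i) = suffix_sign us i - (if i = 0 then b else 0)" for i
    by (cases i) (auto simp: suffix_sign_def b_def)
  have "(\<Sum>i\<le>length (l # us). suffix_sign (l # us) i * cocycle s (drop i (l # us)) z
        * \<phi> (moebius_act (word_mat (drop i (l # us))) z))
      = b * cocycle s (l # us) z * \<phi> (moebius_act (letter_mat l) w)
        + (\<Sum>i\<le>length us. suffix_sign (l # us) (Suc i) * g i)"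
    by (simp add: sum.atMost_Suc_shift act g_def mult.assoc del: sum.atMost_Suc word_mat_simps cocycle.simps)
      (simp add: suffix_sign_def b_def)
  also have "(\<Sum>i\<le>length us. suffix_sign (l # us) (Suc i) * g i)
      = (\<Sum>i\<le>length us. suffix_sign us i * g i) - (\<Sum>i\<le>length us. if i = 0 then b * g 0 else 0)"
    unfolding sign sum_subtractf[symmetric] by (rule sum.cong) (auto simp: algebra_simps)
  also have "\<dots> = cocycle s us z * F w - F z - b * (cocycle s us z * \<phi> w)"
    unfolding IH by (simp add: g_def w_def)
  also have "b * cocycle s (l # us) z * \<phi> (moebius_act (letter_mat l) w) + \<dots>
      = cocycle s (l # us) z * F (moebius_act (letter_mat l) w) - F z"
  proof (cases l)
    case (Inl x)
    then have "F (moebius_act (upp_mat x) w) = F w" using Cons.prems(1) w by auto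
    then show ?thesis by (simp add: Inl b_def letter_mat_def automorphy_factor_def)
  next
    case (Inr y)
    define v where "v = moebius_act (low_mat y) w"
    have "v \<in> upper_half_space" unfolding v_def by (rule moebius_upper_half_space) (use w in auto)
    then have "s v \<noteq> 0" "s w \<noteq> 0" using s w by auto
    moreover have "(\<phi> v - F v) / s v = (\<phi> w - F w) / s w"
      using Cons.prems(2) w Inr by (auto simp: v_def)
    ultimately have "s w / s v * \<phi> v - \<phi> w = s w / s v * F v - F w"
      by (simp add: field_simps)
    then have "cocycle s us z * (s w / s v * \<phi> v - \<phi> w) = cocycle s us z * (s w / s v * F v - F w)"
      by simp
    then show ?thesis
      by (simp add: Inr b_def letter_mat_def automorphy_factor_def v_def[symmetric] w_def[symmetric] algebra_simps)
  qed
  finally show ?case by (simp only: act)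
qed

lemma no_minimal_relator:
  fixes L\<^sub>1 L\<^sub>2 :: "(real^'n) set"
  assumes s: "\<And>w. w \<in> upper_half_space \<Longrightarrow> s w \<noteq> 0"
    and upp: "\<And>r x w. r \<in> nonneg_orthant \<Longrightarrow> x \<in> L\<^sub>1 \<Longrightarrow> w \<in> upper_half_space \<Longrightarrow>
      F r (moebius_act (upp_mat x) w) = F r w"
    and low: "\<And>r y w. r \<in> nonneg_orthant \<Longrightarrow> y \<in> L\<^sub>2 \<Longrightarrow> w \<in> upper_half_space \<Longrightarrow>
      (gauss r (moebius_act (low_mat y) w) - F r (moebius_act (low_mat y) w)) / s (moebius_act (low_mat y) w)
        = (gauss r w - F r w) / s w"
    and inf: "infinite L\<^sub>1"
    and us: "us \<in> lists (L\<^sub>1 <+> L\<^sub>2)" "length us \<ge> 2" "successively (\<lambda>k l. isl k \<noteq> isl l) us"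
    and relator: "PSL2_class (word_mat us) = \<one>\<^bsub>PSL2\<^esub>"
    and minimal: "\<And>p v q. us = p @ v @ q \<Longrightarrow> v \<noteq> [] \<Longrightarrow> p @ q \<noteq> [] \<Longrightarrow>
      PSL2_class (word_mat v) \<noteq> \<one>\<^bsub>PSL2\<^esub>"
  shows False
proof -
  interpret PSL: group "PSL2 :: ((real^'n)^2^2) set monoid" by (rule group_PSL2)
  define m where "m = length us"
  define W where "W i = word_mat (drop i us)" for i
  \<comment> \<open>The full word fixes every point, as does the empty suffix, so the term of index
    \<open>0\<close> is merged into that of index \<open>m\<close>.\<close>
  define K where "K z i = suffix_sign us i * cocycle s (drop i us) z
      + (if i = m then suffix_sign us 0 * cocycle s us z else 0)" for z i
  \<comment> \<open>The factor is computed along the word and may differ from one even for a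
    relator, so \<open>F\<close> can survive with this coefficient.\<close>
  define E where "E z = cocycle s us z - 1" for z
  have m: "m \<ge> 2" using us by (simp add: m_def)
  have detW: "det (W i) = 1" for i by (simp add: W_def)
  have Wm: "moebius_act (W m) z = z" for z by (simp add: W_def m_def)
  have W0: "moebius_act (W 0) z = z" for z
    using moebius_PSL2_class[of "word_mat us" "mat 1" z] relator by (simp add: W_def PSL2_class_one)
  have relation: "(\<Sum>i\<in>{1..m}. K z i * gauss r (moebius_act (W i) z)) = E z * F r z"
    if z: "z \<in> upper_half_space" and r: "r \<in> nonneg_orthant" for z r
  proof -
    let ?f = "\<lambda>i. suffix_sign us i * cocycle s (drop i us) z * gauss r (moebius_act (W i) z)"
    have "E z * F r z = cocycle s us z * F r (moebius_act (word_mat us) z) - F r z"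
      using W0[of z] by (simp add: E_def W_def algebra_simps)
    also have "\<dots> = (\<Sum>i\<le>m. ?f i)"
      unfolding m_def W_def
    proof (rule cocycle_telescope)
      show "F r (moebius_act (upp_mat x) w) = F r w" if "Inl x \<in> set us" "w \<in> upper_half_space" for x w
        using that us upp[OF r] by auto
      show "(gauss r (moebius_act (low_mat y) w) - F r (moebius_act (low_mat y) w))
          / s (moebius_act (low_mat y) w) = (gauss r w - F r w) / s w"
        if "Inr y \<in> set us" "w \<in> upper_half_space" for y w
        using that us low[OF r] by auto
    qed (use s z in auto)
    also have "\<dots> = ?f 0 + (\<Sum>i\<in>{1..m}. ?f i)"
      by (simp add: atMost_atLeast0 sum.atLeast_Suc_atMost)
    also have "?f 0 = (\<Sum>i\<in>{1..m}. if i = m then suffix_sign us 0 * cocycle s us z * gauss r z else 0)"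
      using m by (simp add: W0)
    also have "\<dots> + (\<Sum>i\<in>{1..m}. ?f i) = (\<Sum>i\<in>{1..m}. K z i * gauss r (moebius_act (W i) z))"
      unfolding sum.distrib[symmetric] by (rule sum.cong) (auto simp: K_def Wm algebra_simps)
    finally show ?thesis by simp
  qed
  \<comment> \<open>By alternation exactly one of the first two letters is lower, so the sign is
    \<open>1\<close> or \<open>-1\<close>; \<open>m \<ge> 2\<close> keeps the correction in
    \<open>K\<close> away from index \<open>1\<close>.\<close>
  have K1: "K z 1 \<noteq> 0" if "z \<in> upper_half_space" for z
  proof -
    obtain k l vs where us_eq: "us = k # l # vs" using us(2) by (cases us; cases "tl us") auto
    have "suffix_sign us 1 = of_bool (\<not> isl l) - of_bool (\<not> isl k)"
      by (simp add: us_eq suffix_sign_def)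
    moreover have "isl k \<noteq> isl l" using us(3) unfolding us_eq by simp
    ultimately have "suffix_sign us 1 \<noteq> 0" by (cases "isl k"; cases "isl l") simp_all
    moreover have "cocycle s (drop 1 us) z \<noteq> 0" using s that by (rule cocycle_nonzero)
    moreover have "K z 1 = suffix_sign us 1 * cocycle s (drop 1 us) z" using m by (simp add: K_def)
    ultimately show ?thesis by simp
  qed
  have distinct: "PSL2_class (W i) \<noteq> PSL2_class (W 1)" if "i \<in> {1..m}" "i \<noteq> 1" for i
  proof
    assume eq: "PSL2_class (W i) = PSL2_class (W 1)"
    \<comment> \<open>The letters between the two suffixes: nonempty as \<open>i \<noteq> 1\<close>,
      and a proper subword as the first letter is left out.\<close>
    define v where "v = take (i - 1) (drop 1 us)"
    have split: "drop 1 us = v @ drop i us"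
      using that append_take_drop_id[of "i - 1" "drop 1 us"] by (simp add: v_def)
    have "PSL2_class (W 1) = PSL2_class (word_mat v) \<otimes>\<^bsub>PSL2\<^esub> PSL2_class (W i)"
      unfolding W_def split word_mat_append by (rule PSL2_class_mult) auto
    then have "PSL2_class (word_mat v) = \<one>\<^bsub>PSL2\<^esub>"
      using eq PSL.r_cancel_one'[of "PSL2_class (W 1)" "PSL2_class (word_mat v)"]
      by (simp add: PSL2_class_closed detW)
    moreover have "us = take 1 us @ v @ drop i us" using split by (metis append_take_drop_id)
    moreover have "v \<noteq> []" "take 1 us @ drop i us \<noteq> []" using that m by (auto simp: v_def m_def)
    ultimately show False using minimal by blast
  qed
  have "infinite (T_elt ` L\<^sub>1)"
    using inf finite_imageD inj_on_subset[OF inj_T_elt] by blast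
  \<comment> \<open>Only finitely many translations satisfy \<open>W i\<close> times
    \<open>t\<close> equals \<open>W 1\<close> in \<open>PSL2\<close> for some \<open>i\<close>;
    avoid them all.\<close>
  then obtain t where "t \<in> T_elt ` L\<^sub>1"
    "t \<notin> (\<lambda>i. inv\<^bsub>PSL2\<^esub> (PSL2_class (W i)) \<otimes>\<^bsub>PSL2\<^esub> PSL2_class (W 1)) ` {1..m}"
    by (metis finite_atLeastAtMost finite_imageI finite_subset subsetI)
  then obtain x where x: "x \<in> L\<^sub>1"
    and avoid: "\<And>i. i \<in> {1..m} \<Longrightarrow> T_elt x \<noteq> inv\<^bsub>PSL2\<^esub> (PSL2_class (W i)) \<otimes>\<^bsub>PSL2\<^esub> PSL2_class (W 1)"
    by blast
  define U where "U i = W i ** upp_mat x" for i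
  have detU: "det (U i) = 1" for i by (simp add: U_def det_mul detW)
  have classU: "PSL2_class (U i) = PSL2_class (W i) \<otimes>\<^bsub>PSL2\<^esub> T_elt x" for i
    unfolding U_def T_elt_class by (rule PSL2_class_mult) (auto simp: detW)
  have UW: "PSL2_class (U i) \<noteq> PSL2_class (W 1)" if "i \<in> {1..m}" for i
    using avoid[OF that] PSL.inv_solve_left'[of "T_elt x" "PSL2_class (W i)" "PSL2_class (W 1)"]
    by (metis classU PSL2_class_closed detW T_elt_V_elt_closed(1))
  have UU: "PSL2_class (U i) \<noteq> PSL2_class (U 1)" if "i \<in> {1..m}" "i \<noteq> 1" for i
    using distinct[OF that] by (simp add: classU PSL2_class_closed detW T_elt_V_elt_closed)
  define S where "S = W ` {1..m} \<union> U ` {1..m}"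
  have "finite S" and detS: "\<And>A. A \<in> S \<Longrightarrow> det A = 1" using detW detU by (auto simp: S_def)
  then obtain z where z: "z \<in> upper_half_space"
    and sep: "\<And>A B. A \<in> S \<Longrightarrow> B \<in> S \<Longrightarrow> moebius_act A z = moebius_act B z \<Longrightarrow>
      PSL2_class A = PSL2_class B"
    using exists_separating_point[of S] by meson
  define z' where "z' = moebius_act (upp_mat x) z"
  have z': "z' \<in> upper_half_space" unfolding z'_def by (rule moebius_upper_half_space) (use z in auto)
  have U: "moebius_act (U i) z = moebius_act (W i) z'" for i
    by (simp add: U_def z'_def moebius_mult detW z)
  have F: "F r z' = F r z" if "r \<in> nonneg_orthant" for r
    unfolding z'_def using upp that x z by blast
  \<comment> \<open>If \<open>E z'\<close> vanishes, the relation at \<open>z'\<close> alone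
    contradicts independence. Otherwise the common value of \<open>F\<close> at \<open>z\<close> and
    \<open>z'\<close> is eliminated between the two relations.\<close>
  show False
  proof (cases "E z' = 0")
    case True
    have "K z' 1 = 0"
    proof (rule independent_gauss[where I = "{1..m}" and P = "\<lambda>i. moebius_act (W i) z'"])
      show "moebius_act (W i) z' \<noteq> moebius_act (W 1) z'" if "i \<in> {1..m}" "i \<noteq> 1" for i
        using sep[of "U i" "U 1"] UU[OF that] that m by (auto simp: S_def U[symmetric])
      show "(\<Sum>i\<in>{1..m}. K z' i * gauss r (moebius_act (W i) z')) = 0" if "r \<in> nonneg_orthant" for r
        using relation[OF z' that] True by simp
    qed (use m in auto)
    then show False using K1[OF z'] by simp
  next
    case False
    \<comment> \<open>\<open>Inl\<close> indexes the points over \<open>z\<close> and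
      \<open>Inr\<close> those over \<open>z'\<close>; the distinguished coefficient is
      \<open>E z' * K z 1\<close>, a product of nonzero factors.\<close>
    let ?c = "case_sum (\<lambda>i. E z' * K z i) (\<lambda>i. - E z * K z' i)"
    let ?P = "case_sum (\<lambda>i. moebius_act (W i) z) (\<lambda>i. moebius_act (W i) z')"
    have "?c (Inl 1) = 0"
    proof (rule independent_gauss[where I = "{1..m} <+> {1..m}" and P = ?P])
      show "?P i \<noteq> ?P (Inl 1)" if "i \<in> {1..m} <+> {1..m}" "i \<noteq> Inl 1" for i
      proof (cases i)
        case (Inl k)
        then have k: "k \<in> {1..m}" "k \<noteq> 1" using that by auto
        show ?thesis using sep[of "W k" "W 1"] distinct[OF k] k m by (auto simp: Inl S_def)
      next
        case (Inr k)
        then have k: "k \<in> {1..m}" using that by auto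
        show ?thesis using sep[of "U k" "W 1"] UW[OF k] k m by (auto simp: Inr S_def U[symmetric])
      qed
      show "(\<Sum>i\<in>{1..m} <+> {1..m}. ?c i * gauss r (?P i)) = 0" if r: "r \<in> nonneg_orthant" for r
      proof -
        have "(\<Sum>i\<in>{1..m} <+> {1..m}. ?c i * gauss r (?P i))
            = E z' * (\<Sum>i\<in>{1..m}. K z i * gauss r (moebius_act (W i) z))
              - E z * (\<Sum>i\<in>{1..m}. K z' i * gauss r (moebius_act (W i) z'))"
          by (simp add: sum.Plus sum_distrib_left mult.assoc sum_negf)
        also have "\<dots> = 0"
          unfolding relation[OF z r] relation[OF z' r] F[OF r] by simp
        finally show ?thesis .
      qed
    qed (use m in auto)
    then show False using K1[OF z] False by simp
  qed
qed

section \<open>From the functional equation to the absence of relators\<close>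

theorem proposition4p2:
  fixes d :: "'n::finite \<Rightarrow> nat"
    and \<Lambda>\<^sub>1 \<Lambda>\<^sub>2 :: "(real^'n) set"
    and L\<^sub>1 L\<^sub>2 \<Lambda>\<^sub>1\<^sub>p \<Lambda>\<^sub>2\<^sub>p :: "(real^'n) set"
    and a a' :: "real^'n \<Rightarrow> real^'n \<Rightarrow> complex"
    and F F' :: "complex^'n \<Rightarrow> real^'n \<Rightarrow> complex"
  assumes d: "\<And>j. d j \<ge> 1"
    and lattices: "full_lattice \<Lambda>\<^sub>1" "full_lattice \<Lambda>\<^sub>2"
  defines "\<Lambda>\<^sub>1\<^sub>p \<equiv> \<Lambda>\<^sub>1 \<inter> nonneg_orthant"
    and "\<Lambda>\<^sub>2\<^sub>p \<equiv> \<Lambda>\<^sub>2 \<inter> nonneg_orthant"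
    and "L\<^sub>1 \<equiv> (\<lambda>x. 2 *\<^sub>R x) ` dual_lattice \<Lambda>\<^sub>1"
    and "L\<^sub>2 \<equiv> (\<lambda>x. 2 *\<^sub>R x) ` dual_lattice \<Lambda>\<^sub>2"
  assumes growth: "\<And>r. r \<in> nonneg_orthant \<Longrightarrow> polynomial_growth \<Lambda>\<^sub>1\<^sub>p (\<lambda>l. a l r)"
    and growth': "\<And>r. r \<in> nonneg_orthant \<Longrightarrow> polynomial_growth \<Lambda>\<^sub>2\<^sub>p (\<lambda>m. a' m r)"
  defines "F \<equiv> \<lambda>z r. exp_series \<Lambda>\<^sub>1\<^sub>p (\<lambda>l. a l r) z"
    and "F' \<equiv> \<lambda>z r. exp_series \<Lambda>\<^sub>2\<^sub>p (\<lambda>m. a' m r) z"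
  assumes functional_equation:
    "\<And>z r. z \<in> upper_half_space \<Longrightarrow> r \<in> nonneg_orthant \<Longrightarrow>
      exp (of_real pi * \<i> * (\<Sum>j\<in>UNIV. z $ j * of_real ((r $ j)^2)))
        = F z r + (\<Prod>j\<in>UNIV. (z $ j / \<i>) powr (- of_nat (d j) / 2)) * F' (\<chi> j. - 1 / z $ j) r"
  shows "free_inner_product (Gamma_gen L\<^sub>1 L\<^sub>2) (Gamma_upp L\<^sub>1) (Gamma_low L\<^sub>2)"
proof -
  interpret PSL: group "PSL2 :: ((real^'n)^2^2) set monoid" by (rule group_PSL2)
  define s where "s z = (\<Prod>j\<in>UNIV. (z $ j / \<i>) powr (- of_nat (d j) / 2))" for z :: "complex^'n"
  have nonzero: "z $ j \<noteq> 0" if "z \<in> upper_half_space" for z :: "complex^'n" and j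
    using that by (auto simp: upper_half_space_def dest!: spec[of _ j])
  then have s: "s z \<noteq> 0" if "z \<in> upper_half_space" for z
    using that by (simp add: s_def)
  have F'_eq: "(gauss r z - F z r) / s z = F' (\<chi> j. - 1 / z $ j) r"
    if "z \<in> upper_half_space" "r \<in> nonneg_orthant" for z r
    using functional_equation[OF that] s[OF that(1)] by (simp add: gauss_def s_def)
  have upp: "F (moebius_act (upp_mat x) z) r = F z r" if "x \<in> L\<^sub>1" for x z r
  proof -
    obtain y where y: "y \<in> dual_lattice \<Lambda>\<^sub>1" "x = 2 *\<^sub>R y" using \<open>x \<in> L\<^sub>1\<close> by (auto simp: L\<^sub>1_def)
    have "moebius_act (upp_mat x) z = z + (\<chi> j. of_real (2 * y $ j))"
      by (simp add: moebius_act_def upp_mat_def y(2) vec_eq_iff)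
    then show ?thesis
      using exp_series_periodic[OF y(1), of \<Lambda>\<^sub>1\<^sub>p] by (simp add: F_def \<Lambda>\<^sub>1\<^sub>p_def)
  qed
  have low: "(gauss r (moebius_act (low_mat y) z) - F (moebius_act (low_mat y) z) r) / s (moebius_act (low_mat y) z)
      = (gauss r z - F z r) / s z"
    if r: "r \<in> nonneg_orthant" and "y \<in> L\<^sub>2" and z: "z \<in> upper_half_space" for r y z
  proof -
    obtain x where x: "x \<in> dual_lattice \<Lambda>\<^sub>2" "y = 2 *\<^sub>R x" using \<open>y \<in> L\<^sub>2\<close> by (auto simp: L\<^sub>2_def)
    have w: "moebius_act (low_mat y) z \<in> upper_half_space"
      by (rule moebius_upper_half_space) (use z in auto)
    \<comment> \<open>Inversion conjugates the lower letter into a translation: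
      \<open>-1 / (z / (y * z + 1)) = -1 / z - y\<close>. Hence periodicity of \<open>F'\<close>
      applies.\<close>
    have "(\<chi> j. - 1 / moebius_act (low_mat y) z $ j) = (\<chi> j. - 1 / z $ j) + (\<chi> j. of_real (2 * (- x) $ j))"
      using nonzero[OF z] by (simp add: moebius_act_def low_mat_def x(2) vec_eq_iff field_simps)
    then show ?thesis
      using exp_series_periodic[OF dual_lattice_closed(3)[OF x(1)], of \<Lambda>\<^sub>2\<^sub>p]
      by (simp only: F'_eq z w r F'_def) (simp add: \<Lambda>\<^sub>2\<^sub>p_def)
  qed
  have closed: "0 \<in> L \<and> (\<forall>x\<in>L. \<forall>y\<in>L. x + y \<in> L) \<and> (\<forall>x\<in>L. - x \<in> L)"
    if L: "L = (\<lambda>x. 2 *\<^sub>R x) ` dual_lattice \<Lambda>" for L \<Lambda> :: "(real^'n) set"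
  proof (intro conjI ballI)
    show "0 \<in> L" unfolding L by (rule image_eqI[of _ _ 0]) (simp_all add: dual_lattice_closed)
    fix x assume "x \<in> L"
    then obtain u where u: "u \<in> dual_lattice \<Lambda>" "x = 2 *\<^sub>R u" unfolding L by blast
    show "- x \<in> L"
      unfolding L by (rule image_eqI[of _ _ "- u"]) (simp_all add: u dual_lattice_closed)
    fix y assume "y \<in> L"
    then obtain v where v: "v \<in> dual_lattice \<Lambda>" "y = 2 *\<^sub>R v" unfolding L by blast
    show "x + y \<in> L"
      unfolding L by (rule image_eqI[of _ _ "u + v"]) (simp_all add: u v dual_lattice_closed scaleR_add_right)
  qed
  have subT: "subgroup (Gamma_upp L\<^sub>1) PSL2" and subV: "subgroup (Gamma_low L\<^sub>2) PSL2"
    unfolding Gamma_upp_def Gamma_low_def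
    using closed[OF L\<^sub>1_def[THEN meta_eq_to_obj_eq]] closed[OF L\<^sub>2_def[THEN meta_eq_to_obj_eq]]
    by (intro subgroup_image_additive group_PSL2 T_elt_V_elt_closed T_elt_add V_elt_add; blast)+
  let ?S = "Gamma_upp L\<^sub>1 \<union> Gamma_low L\<^sub>2"
  have S: "?S \<subseteq> carrier PSL2"
    by (auto simp: Gamma_upp_def Gamma_low_def T_elt_V_elt_closed)
  have gen: "subgroup (generate PSL2 ?S) PSL2"
    by (rule PSL.generate_is_subgroup[OF S])
  have incl: "?S \<subseteq> generate PSL2 ?S" by (auto intro: generate.incl)
  show ?thesis
  proof (rule free_inner_productI)
    show "subgroup (Gamma_upp L\<^sub>1) (Gamma_gen L\<^sub>1 L\<^sub>2)" "subgroup (Gamma_low L\<^sub>2) (Gamma_gen L\<^sub>1 L\<^sub>2)"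
      unfolding Gamma_gen_def using incl by (auto intro: PSL.subgroup_incl subT subV gen)
    show "carrier (Gamma_gen L\<^sub>1 L\<^sub>2) \<subseteq> generate (Gamma_gen L\<^sub>1 L\<^sub>2) ?S"
      unfolding Gamma_gen_def using PSL.generate_consistent[OF incl gen] by simp
    show False
      if u: "u \<in> lists (Gamma_upp L\<^sub>1 <+> Gamma_low L\<^sub>2)" "length u \<ge> 2"
          "successively (\<lambda>k l. isl k \<noteq> isl l) u"
          "free_product_eval (Gamma_gen L\<^sub>1 L\<^sub>2) (\<lambda>x. x) (\<lambda>x. x) u = \<one>\<^bsub>Gamma_gen L\<^sub>1 L\<^sub>2\<^esub>"
        and minimal: "\<And>p v q. u = p @ v @ q \<Longrightarrow> v \<noteq> [] \<Longrightarrow> p @ q \<noteq> [] \<Longrightarrow>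
          free_product_eval (Gamma_gen L\<^sub>1 L\<^sub>2) (\<lambda>x. x) (\<lambda>x. x) v \<noteq> \<one>\<^bsub>Gamma_gen L\<^sub>1 L\<^sub>2\<^esub>" for u
    proof -
      \<comment> \<open>Lift the word of group elements to a word of lattice vectors, keeping length
        and alternation.\<close>
      have "Gamma_upp L\<^sub>1 <+> Gamma_low L\<^sub>2 = map_sum T_elt V_elt ` (L\<^sub>1 <+> L\<^sub>2)"
        by (auto simp: Gamma_upp_def Gamma_low_def image_iff Plus_def image_Un image_image)
      then obtain us where us: "us \<in> lists (L\<^sub>1 <+> L\<^sub>2)" "u = map (map_sum T_elt V_elt) us"
        using u(1) by (auto simp: lists_image)
      have one: "\<one>\<^bsub>Gamma_gen L\<^sub>1 L\<^sub>2\<^esub> = \<one>\<^bsub>PSL2\<^esub>" by (simp add: Gamma_gen_def)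
      show False
      proof (rule no_minimal_relator[where s = s and F = "\<lambda>r z. F z r" and L\<^sub>1 = L\<^sub>1 and L\<^sub>2 = L\<^sub>2 and us = us])
        show "infinite L\<^sub>1"
          unfolding L\<^sub>1_def using infinite_dual_lattice[OF lattices(1)]
          by (subst finite_image_iff) (auto simp: inj_on_def)
        show "length us \<ge> 2" "successively (\<lambda>k l. isl k \<noteq> isl l) us"
          using u us by (auto simp: successively_map isl_map_sum)
        show "PSL2_class (word_mat us) = \<one>\<^bsub>PSL2\<^esub>"
          using u(4) unfolding us(2) free_product_eval_elts one .
        show "PSL2_class (word_mat v) \<noteq> \<one>\<^bsub>PSL2\<^esub>"
          if "us = p @ v @ q" "v \<noteq> []" "p @ q \<noteq> []" for p v q
          using minimal[of "map (map_sum T_elt V_elt) p" "map (map_sum T_elt V_elt) v"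
              "map (map_sum T_elt V_elt) q"] that
          unfolding free_product_eval_elts one us(2) by simp
      qed (use s upp low us in auto)
    qed
  qed (rule group_Gamma_gen)
qed

end
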